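(* Let $l\geqslant 1$ and $d\geqslant 1$ be integers, let $\Omega$ be a finite subgraph of $\mathbb{Z}^d$, and let $\lambda_1^l(\Omega)\leqslant\lambda_2^l(\Omega)\leqslant\dots\leqslant\lambda_{|\Omega|}^l(\Omega)$ be the eigenvalues of the Dirichlet poly-Laplace eigenvalue problem $(-1)^l\Delta_\Omega^{l,\mathcal D}f=\lambda^l f$ in $\Omega$. Let $V_d$ be the volume of the unit ball in $\mathbb{R}^d$. (a) For all integers $k$ with $1\leqslant k\leqslant\min\{1,\frac{V_d}{2^d}\}|\Omega|$, $$\frac1k\sum_{j=1}^k\lambda_j^l(\Omega)\leqslant(2\pi)^{2l}\frac{d}{d+2l}\Big(\frac{k}{V_d|\Omega|}\Big)^{\frac{2l}{d}}+\frac{|\partial^l\Omega|}{|\Omega|}.$$ For all integers $k$ with $1\leqslant k\leqslant\min\{1,\frac{V_d}{2^{d+1}}\}|\Omega|$, $$\lambda_{k+1}^l(\Omega)\leqslant(2\pi)^{2l}\frac{d\cdot 2^{\frac{d+2l}{d}}}{d+2l}\Big(\frac{k}{V_d|\Omega|}\Big)^{\frac{2l}{d}}+2\frac{|\partial^l\Omega|}{|\Omega|}.$$ Here $$|\partial^l\Omega|=\sum_{x\in\delta_1\Omega\cup\dots\cup\delta_l\Omega}\ \sum_{y\in B(x,l)\cap\Omega}|a_{xy}^l|,$$ and this quantity satisfies $$|\partial^l\Omega|\leqslant 4^l d^l\big(|\delta_1\Omega|+\dots+|\delta_l\Omega|\big).$$ (b) For all integers $k$ with $1\leqslant k\leqslant\min\{1,(\frac{\sqrt6}{2\pi})^dV_d\}|\Omega|$,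 $$\lambda_k^l(\Omega)\geqslant\frac1k\sum_{j=1}^k\lambda_j^l(\Omega)\geqslant\sum_{m=0}^l\binom{l}{m}\Big(-\frac1{12}\Big)^m(2\pi)^{2(l+m)}\frac{d}{d+2(l+m)}\Big(\frac{k}{V_d|\Omega|}\Big)^{\frac{2(l+m)}{d}}>0.$$
   Context: $\mathbb{Z}^d$ is regarded as a graph: $x\sim y$ iff $x-y\in\{\pm e_1,\dots,\pm e_d\}$, where $e_i$ are the standard basis vectors; every vertex has degree $\deg(y)=2d$. $d(x,y)$ is the graph distance and $B(x,r)=\{y:d(x,y)\leqslant r\}$. The graph Laplacian of $f:\mathbb{Z}^d\to\mathbb{C}$ is $\Delta f(x)=\sum_{y\sim x}(f(y)-f(x))$, and $\Delta^l$ is its $l$-fold iterate. For a finite subgraph $\Omega$ (identified with its vertex set; $|\Omega|$ is its number of vertices) and $f:\Omega\to\mathbb{C}$, let $f^*$ be the extension of $f$ by zero to $\mathbb{Z}^d$. The Dirichlet poly-Laplace operator is $\Delta_\Omega^{l,\mathcal D}f=(\Delta^l f^* )|_\Omega$. The operator $(-1)^l\Delta_\Omega^{l,\mathcal D}$ on functions on $\Omega$ is self-adjoint; its $|\Omega|$ real eigenvalues, counted with multiplicity and in nondecreasing order, are denoted $\lambda_1^l(\Omega)\leqslant\dots\leqslant\lambda_{|\Omega|}^l(\Omega)$ (the superscript $l$ is an index indicating the order, not a power). Boundary layers: $\delta\Omega=\delta_1\Omega=\{y\notin\Omega:\exists x\in\Omega,\ y\sim x\}$, and for $l\geqslant2$,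 $\delta_l\Omega=\delta(\Omega\cup\delta_1\Omega\cup\dots\cup\delta_{l-1}\Omega)$. Coefficients: $a_{xy}^l=\sum_{m=0}^l\binom lm(-1)^m(\deg(y))^{l-m}p_m(x,y)$, where $p_m(x,y)$ is the number of paths $x=z_0\sim z_1\sim\dots\sim z_m=y$ of length $m$ from $x$ to $y$ (vertices may repeat). Thus $(-\Delta)^lf(x)=\sum_{y\in B(x,l)}a_{xy}^lf(y)$ on $\mathbb{Z}^d$. *)

theory Defs
  imports "HOL-Analysis.Analysis" "HOL-Library.Function_Algebras"
begin

definition adj :: "int ^ 'd::finite \<Rightarrow> int ^ 'd \<Rightarrow> bool" where
  "adj x y \<longleftrightarrow> x - y \<in> (\<Union>i. {axis i 1, - axis i 1})"

definition lattice_deg :: "int ^ 'd::finite \<Rightarrow> nat" where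
  "lattice_deg x = card {y. adj x y}"

lemma neighbours_eq:
  "{y. adj x y} = (\<lambda>(i, s). x - axis i s) ` (UNIV \<times> {1, -1})"
proof -
  have neg: "- axis i (1::int) = axis i (-1)" for i :: 'a
    by (simp add: axis_def vec_eq_iff)
  show ?thesis
    by (auto simp: adj_def neg image_iff algebra_simps)
qed

lemma finite_neighbours: "finite {y. adj x y}"
  unfolding neighbours_eq by simp

lemma lattice_deg_eq: "lattice_deg (x :: int ^ 'd::finite) = 2 * CARD('d)"
proof -
  have "inj_on (\<lambda>(i :: 'd, s :: int). x - axis i s) (UNIV \<times> {1, -1})"
    by (auto simp: inj_on_def axis_eq_axis)
  then show ?thesis
    by (simp add: lattice_deg_def neighbours_eq card_image card_cartesian_product)
qed

definition walks :: "nat \<Rightarrow> int ^ 'd::finite \<Rightarrow> int ^ 'd \<Rightarrow> (int ^ 'd) list set" where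
  "walks m x y = {z. length z = Suc m \<and> z ! 0 = x \<and> z ! m = y \<and> (\<forall>i<m. adj (z ! i) (z ! Suc i))}"

definition graph_dist :: "int ^ 'd::finite \<Rightarrow> int ^ 'd \<Rightarrow> nat" where
  "graph_dist x y = (LEAST m. walks m x y \<noteq> {})"

definition graph_ball :: "int ^ 'd::finite \<Rightarrow> nat \<Rightarrow> (int ^ 'd) set" where
  "graph_ball x r = {y. graph_dist x y \<le> r}"

definition laplacian :: "(int ^ 'd::finite \<Rightarrow> complex) \<Rightarrow> int ^ 'd \<Rightarrow> complex" where
  "laplacian f x = (\<Sum>y\<in>{y. adj x y}. f y - f x)"

definition zero_ext :: "(int ^ 'd::finite) set \<Rightarrow> (int ^ 'd \<Rightarrow> complex) \<Rightarrow> int ^ 'd \<Rightarrow> complex" where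
  "zero_ext \<Omega> f = (\<lambda>x. if x \<in> \<Omega> then f x else 0)"

text \<open>A complex function on \<open>\<Omega>\<close> is represented by the function on the whole lattice that
  agrees with it on \<open>\<Omega>\<close> and vanishes elsewhere.\<close>

definition functions_on :: "(int ^ 'd::finite) set \<Rightarrow> (int ^ 'd \<Rightarrow> complex) set" where
  "functions_on \<Omega> = {f. \<forall>x. x \<notin> \<Omega> \<longrightarrow> f x = 0}"

definition dirichlet_poly_laplace ::
    "nat \<Rightarrow> (int ^ 'd::finite) set \<Rightarrow> (int ^ 'd \<Rightarrow> complex) \<Rightarrow> int ^ 'd \<Rightarrow> complex" where
  "dirichlet_poly_laplace l \<Omega> f = zero_ext \<Omega> ((laplacian ^^ l) (zero_ext \<Omega> f))"

definition dirichlet_eigenspace :: "nat \<Rightarrow> (int ^ 'd::finite) set \<Rightarrow> real \<Rightarrow> (int ^ 'd \<Rightarrow> complex) set" where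
  "dirichlet_eigenspace l \<Omega> t = {f \<in> functions_on \<Omega>.
     \<forall>x\<in>\<Omega>. (-1) ^ l * dirichlet_poly_laplace l \<Omega> f x = complex_of_real t * f x}"

lemma vector_space_complex_fun:
  "vector_space (\<lambda>(c::complex) (f :: 'a \<Rightarrow> complex) x. c * f x)"
  by unfold_locales (auto simp: fun_eq_iff algebra_simps)

text \<open>Only real \<open>t\<close> are considered: since \<open>(-1)\<^sup>l \<Delta>\<^sub>\<Omega>\<close> is self-adjoint, all its eigenvalues are
  real, and the multiplicity of an eigenvalue is the complex dimension of its eigenspace.\<close>

definition dirichlet_multiplicity :: "nat \<Rightarrow> (int ^ 'd::finite) set \<Rightarrow> real \<Rightarrow> nat" where
  "dirichlet_multiplicity l \<Omega> t =
     vector_space.dim (\<lambda>(c::complex) (f :: int ^ 'd \<Rightarrow> complex) x. c * f x) (dirichlet_eigenspace l \<Omega> t)"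

definition dirichlet_eigenvalue_set :: "nat \<Rightarrow> (int ^ 'd::finite) set \<Rightarrow> real set" where
  "dirichlet_eigenvalue_set l \<Omega> = {t. \<exists>f\<in>dirichlet_eigenspace l \<Omega> t. f \<noteq> 0}"

definition dirichlet_eigenvalue_list :: "nat \<Rightarrow> (int ^ 'd::finite) set \<Rightarrow> real list" where
  "dirichlet_eigenvalue_list l \<Omega> =
     concat (map (\<lambda>t. replicate (dirichlet_multiplicity l \<Omega> t) t) (sorted_list_of_set (dirichlet_eigenvalue_set l \<Omega>)))"

text \<open>Eigenvalues are numbered from 1, list positions from 0.\<close>

definition dirichlet_eigenvalue :: "nat \<Rightarrow> (int ^ 'd::finite) set \<Rightarrow> nat \<Rightarrow> real" where
  "dirichlet_eigenvalue l \<Omega> j = dirichlet_eigenvalue_list l \<Omega> ! (j - 1)"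

definition vertex_boundary :: "(int ^ 'd::finite) set \<Rightarrow> (int ^ 'd) set" where
  "vertex_boundary \<Omega> = {y. y \<notin> \<Omega> \<and> (\<exists>x\<in>\<Omega>. adj y x)}"

text \<open>Layers are numbered from 1; the value at index 0 is never used.\<close>

fun boundary_layer :: "nat \<Rightarrow> (int ^ 'd::finite) set \<Rightarrow> (int ^ 'd) set" where
  "boundary_layer l \<Omega> = vertex_boundary (\<Omega> \<union> (\<Union>i\<in>{1..<l}. boundary_layer i \<Omega>))"

declare boundary_layer.simps [simp del]

text \<open>The kernel of \<open>(- \<Delta>)\<^sup>l\<close> as an operator on functions on the lattice: binomial expansion of
  the \<open>l\<close>-th power of degree minus adjacency.\<close>

definition coeff_a :: "nat \<Rightarrow> int ^ 'd::finite \<Rightarrow> int ^ 'd \<Rightarrow> real" where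
  "coeff_a l x y =
     (\<Sum>m=0..l. real (l choose m) * (-1) ^ m * real (lattice_deg y) ^ (l - m) * real (card (walks m x y)))"

definition boundary_size :: "nat \<Rightarrow> (int ^ 'd::finite) set \<Rightarrow> real" where
  "boundary_size l \<Omega> =
     (\<Sum>x\<in>(\<Union>i\<in>{1..l}. boundary_layer i \<Omega>). \<Sum>y\<in>graph_ball x l \<inter> \<Omega>. \<bar>coeff_a l x y\<bar>)"

end

theory Submission
  imports Defs "HOL-Computational_Algebra.Fundamental_Theorem_Algebra"
begin

text \<open>
  The function \<open>wave z x = cis (x \<bullet> z)\<close> satisfies \<open>(- \<Delta>)\<^sup>l (wave z) = symbol z ^ l * wave z\<close>
  with \<open>symbol z = (\<Sum>i. 2 - 2 cos (z\<^sub>i))\<close>, and the functions \<open>z \<mapsto> wave z x\<close>, one for each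
  lattice point \<open>x\<close>, are orthogonal over the cube \<open>[-\<pi>, \<pi>]\<^sup>d\<close> with square norm \<open>(2\<pi>)\<^sup>d\<close>. On the lattice the Dirichlet operator is
  the matrix \<open>coeff_a l x y\<close> restricted to \<open>\<Omega> \<times> \<Omega>\<close>, which is real and symmetric; fix an
  orthonormal basis \<open>\<phi>\<^sub>i\<close> of eigenfunctions, with eigenvalues \<open>\<mu>\<^sub>0 \<le> \<mu>\<^sub>1 \<le> \<dots>\<close>, and put
  \<open>D\<^sub>i(z) = |\<langle>wave z, \<phi>\<^sub>i\<rangle>|\<^sup>2\<close>, the inner product being taken over \<open>\<Omega>\<close>. All estimates come from
  four facts about these densities:
  \<^item> \<open>\<Sum>\<^sub>i D\<^sub>i(z) = |\<Omega>|\<close> for every \<open>z\<close> (Parseval on \<open>\<Omega>\<close>: \<open>sum_eigen_density\<close>);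
  \<^item> \<open>\<integral> D\<^sub>i = (2\<pi>)\<^sup>d\<close> over the cube (Plancherel on the lattice: \<open>integral_eigen_density\<close>);
  \<^item> \<open>\<integral> symbol ^ l * D\<^sub>i = (2\<pi>)\<^sup>d \<mu>\<^sub>i\<close> (\<open>integral_eigen_density_symbol\<close>);
  \<^item> \<open>\<Sum>\<^sub>i \<mu>\<^sub>i D\<^sub>i(z) \<le> |\<Omega>| symbol z ^ l + boundary_size l \<Omega>\<close>, because cutting the wave off outside
    \<open>\<Omega>\<close> drops only matrix entries joining \<open>\<Omega>\<close> to its first \<open>l\<close> boundary layers
    (\<open>wave_energy_le\<close>).

  Upper bounds (Kroeger's method). Integrate the last fact over a ball \<open>B\<close> of radius \<open>r \<le> \<pi>\<close>. The
  weights \<open>w\<^sub>i = \<integral>\<^sub>B D\<^sub>i\<close> lie in \<open>[0, (2\<pi>)\<^sup>d]\<close> and add up to \<open>|\<Omega>| |B|\<close>. If \<open>|\<Omega>| |B| = (2\<pi>)\<^sup>d k\<close>,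
  then \<open>\<Sum> \<mu>\<^sub>i w\<^sub>i\<close> is smallest when the whole weight sits on the \<open>k\<close> lowest eigenvalues, so it is at
  least \<open>(2\<pi>)\<^sup>d (\<mu>\<^sub>0 + \<dots> + \<mu>\<^bsub>k-1\<^esub>)\<close> (\<open>weighted_sum_ge_initial_sum\<close>). With \<open>2k\<close> in place of \<open>k\<close>, a
  weight of at least \<open>(2\<pi>)\<^sup>d k\<close> is left for the indices from \<open>k\<close> on, which bounds the single
  eigenvalue \<open>\<mu>\<^sub>k\<close> because no eigenvalue is negative. The integral over \<open>B\<close> is computed from \<open>symbol z \<le> |z|\<^sup>2\<close>.

  Lower bound (Berezin, Li and Yau). The function \<open>F = D\<^sub>0 + \<dots> + D\<^bsub>k-1\<^esub>\<close> satisfies \<open>0 \<le> F \<le> |\<Omega>|\<close>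
  and \<open>\<integral> F = (2\<pi>)\<^sup>d k\<close>, so against a radially nondecreasing weight \<open>\<integral> weight * F\<close> is smallest when
  \<open>F\<close> is \<open>|\<Omega>|\<close> times the indicator of a centred ball. The symbol is not radial, but it dominates
  \<open>minorant (|z|\<^sup>2)\<close>, where \<open>minorant s\<close> equals \<open>s - s\<^sup>2/12\<close> up to its maximum at \<open>s = 6\<close> and is
  constant from there on; this works because that function is concave and vanishes at \<open>0\<close>, hence is
  subadditive (\<open>minorant_le_symbol\<close>). Expanding \<open>(|z|\<^sup>2 - |z|\<^sup>4/12) ^ l\<close> over a ball of radius at
  most \<open>\<surd>6\<close> gives the stated sum.
\<close>

section \<open>Hermitian kernels on finite sets\<close>

interpretation cfun: vector_space "\<lambda>(c::complex) (f :: 'a \<Rightarrow> complex) x. c * f x"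
  by (rule vector_space_complex_fun)

lemma sum_fun_apply: "(\<Sum>i\<in>I. f i) x = (\<Sum>i\<in>I. f i x)"
  for f :: "'i \<Rightarrow> 'a \<Rightarrow> 'b::comm_monoid_add"
  by (induction I rule: infinite_finite_induct) auto

definition kernel_op :: "'a set \<Rightarrow> ('a \<Rightarrow> 'a \<Rightarrow> complex) \<Rightarrow> ('a \<Rightarrow> complex) \<Rightarrow> 'a \<Rightarrow> complex" where
  "kernel_op S K f = (\<lambda>x. if x \<in> S then \<Sum>y\<in>S. K x y * f y else 0)"

definition inner_on :: "'a set \<Rightarrow> ('a \<Rightarrow> complex) \<Rightarrow> ('a \<Rightarrow> complex) \<Rightarrow> complex" where
  "inner_on S f g = (\<Sum>x\<in>S. f x * cnj (g x))"

definition supported :: "'a set \<Rightarrow> ('a \<Rightarrow> complex) \<Rightarrow> bool" where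
  "supported S f \<longleftrightarrow> (\<forall>x. x \<notin> S \<longrightarrow> f x = 0)"

lemma supported_in_span:
  assumes "finite S" "supported S f"
  shows "f \<in> cfun.span ((\<lambda>s x. if x = s then 1 else 0) ` S)"
proof -
  have "f = (\<Sum>s\<in>S. (\<lambda>x. f s * (if x = s then 1 else 0)))"
  proof
    fix x
    show "f x = (\<Sum>s\<in>S. (\<lambda>x. f s * (if x = s then 1 else 0))) x"
      using assms
      by (cases "x \<in> S") (auto simp: sum_fun_apply supported_def if_distrib[of "\<lambda>z. _ * z"] cong: if_cong)
  qed
  also have "\<dots> \<in> cfun.span ((\<lambda>s x. if x = s then 1 else 0) ` S)"
    by (intro cfun.span_sum cfun.span_scale cfun.span_base) auto
  finally show ?thesis .
qed

text \<open>Functions on \<open>S\<close> lie in the span of \<open>card S\<close> point masses. The dependency is returned as a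
  polynomial, since below the family consists of the iterates of an operator at one function.\<close>

lemma supported_family_dependent:
  fixes v :: "nat \<Rightarrow> 'a \<Rightarrow> complex"
  assumes "finite S" "\<And>i. supported S (v i)"
  shows "\<exists>p. p \<noteq> 0 \<and> (\<forall>x. (\<Sum>i\<le>degree p. coeff p i * v i x) = 0)"
proof (cases "inj_on v {..card S}")
  case False
  then obtain i j where ij: "i < j" "v i = v j"
    by (metis inj_onI linorder_neq_iff)
  \<comment> \<open>a repetition in the family is itself a dependency\<close>
  define p :: "complex poly" where "p = monom 1 j - monom 1 i"
  have c: "coeff p n = (if n = j then 1 else if n = i then -1 else 0)" for n
    using ij by (auto simp: p_def)
  have deg: "degree p = j"
    using ij by (intro antisym degree_le le_degree) (auto simp: c)
  have "p \<noteq> 0"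
    using c[of j] by auto
  moreover have "(\<Sum>n\<le>degree p. coeff p n * v n x) = 0" for x
  proof -
    have "(\<Sum>n\<le>degree p. coeff p n * v n x) = (\<Sum>n\<in>{i,j}. coeff p n * v n x)"
      using ij by (intro sum.mono_neutral_right) (auto simp: deg c)
    also have "\<dots> = 0"
      using ij by (auto simp: c)
    finally show ?thesis .
  qed
  ultimately show ?thesis by blast
next
  case True
  let ?T = "v ` {..card S}"
  have "cfun.dependent ?T"
  proof (rule ccontr)
    assume "\<not> cfun.dependent ?T"
    moreover have "?T \<subseteq> cfun.span ((\<lambda>s x. if x = s then 1 else 0) ` S)"
      using supported_in_span assms by blast
    ultimately have "card ?T \<le> card ((\<lambda>s x. if x = s then 1 else 0 :: complex) ` S)"
      using cfun.independent_span_bound assms(1) finite_imageI by blast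
    also have "\<dots> \<le> card S"
      by (rule card_image_le[OF assms(1)])
    finally show False
      using True by (simp add: card_image)
  qed
  then obtain u where u: "\<exists>f\<in>?T. u f \<noteq> 0" "(\<Sum>f\<in>?T. (\<lambda>x. u f * f x)) = 0"
    by (subst (asm) cfun.dependent_finite) auto
  define p where "p = (\<Sum>i\<le>card S. monom (u (v i)) i)"
  have c: "coeff p n = (if n \<le> card S then u (v n) else 0)" for n
    by (auto simp: p_def coeff_sum)
  have "p \<noteq> 0"
    using u(1) c by (metis coeff_0 imageE atMost_iff)
  moreover have "(\<Sum>n\<le>degree p. coeff p n * v n x) = 0" for x
  proof -
    have "(\<Sum>n\<le>degree p. coeff p n * v n x) = (\<Sum>n\<le>card S. coeff p n * v n x)"
    proof (rule sum.mono_neutral_left)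
      show "{..degree p} \<subseteq> {..card S}"
        using degree_le[of "card S" p] by (simp add: c)
      show "\<forall>i\<in>{..card S} - {..degree p}. coeff p i * v i x = 0"
        by (simp add: coeff_eq_0)
    qed simp
    also have "\<dots> = (\<Sum>f\<in>?T. u f * f x)"
      using True by (simp add: sum.reindex c)
    also have "\<dots> = (\<Sum>f\<in>?T. (\<lambda>x. u f * f x)) x"
      by (simp add: sum_fun_apply)
    also have "\<dots> = 0"
      by (simp add: u(2))
    finally show ?thesis .
  qed
  ultimately show ?thesis by blast
qed

lemma kernel_op_supported [simp]: "supported S (kernel_op S K f)"
  by (simp add: supported_def kernel_op_def)

lemma kernel_op_sum:
  "kernel_op S K (\<lambda>x. \<Sum>i\<in>I. c i * f i x) = (\<lambda>x. \<Sum>i\<in>I. c i * kernel_op S K (f i) x)"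
  by (auto simp: kernel_op_def fun_eq_iff sum_distrib_left mult_ac intro: sum.swap)

text \<open>In a nonzero invariant subspace some polynomial in the operator annihilates a nonzero vector
  \<open>f\<close>; for one of least degree, splitting off a linear factor \<open>X - a\<close> leaves a nonzero vector
  annihilated by the operator minus \<open>a\<close>.\<close>

lemma kernel_op_eigenvector:
  assumes S: "finite S" and W: "cfun.subspace W" "\<And>f. f \<in> W \<Longrightarrow> supported S f"
    and inv: "\<And>f. f \<in> W \<Longrightarrow> kernel_op S K f \<in> W"
    and f: "f \<in> W" "f \<noteq> 0"
  obtains g c where "g \<in> W" "g \<noteq> 0" "\<And>x. kernel_op S K g x = c * g x"
proof -
  let ?T = "kernel_op S K"
  define E where "E p = (\<lambda>x. \<Sum>i\<le>degree p. coeff p i * (?T ^^ i) f x)" for p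
  have it: "(?T ^^ i) f \<in> W" for i
    by (induction i) (use f inv in auto)
  have "\<exists>p. p \<noteq> 0 \<and> E p = 0"
    using supported_family_dependent[OF S, of "\<lambda>i. (?T ^^ i) f"] it W(2)
    by (auto simp: E_def fun_eq_iff)
  then obtain p where p: "p \<noteq> 0" "E p = 0"
    and least: "\<And>q. degree q < degree p \<Longrightarrow> \<not> (q \<noteq> 0 \<and> E q = 0)"
    using exists_least_iff[of "\<lambda>n. \<exists>p. degree p = n \<and> p \<noteq> 0 \<and> E p = 0"] by metis
  have "degree p \<noteq> 0"
  proof
    assume 0: "degree p = 0"
    then obtain c where "p = [:c:]" by (metis degree_eq_zeroE)
    with p f(2) show False
      by (auto simp: E_def fun_eq_iff)
  qed
  then have "\<not> constant (poly p)"
    by (simp only: constant_degree not_False_eq_True)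
  from fundamental_theorem_of_algebra[OF this] obtain a where "poly p a = 0" ..
  then have "[:-a, 1:] dvd p"
    by (simp only: poly_eq_0_iff_dvd)
  then obtain q where q: "p = [:-a, 1:] * q" ..
  with p have "q \<noteq> 0" by auto
  then have deg: "degree p = Suc (degree q)"
    unfolding q by (subst degree_mult_eq) auto
  then have "E q \<noteq> 0"
    using least[of q] \<open>q \<noteq> 0\<close> by simp
  moreover have "E q \<in> W"
  proof -
    have "E q = (\<Sum>i\<le>degree q. (\<lambda>x. coeff q i * (?T ^^ i) f x))"
      by (simp add: E_def fun_eq_iff sum_fun_apply)
    also have "\<dots> \<in> W"
      by (intro cfun.subspace_sum cfun.subspace_scale W(1) it)
    finally show ?thesis .
  qed
  moreover have "?T (E q) x = a * E q x" for x
  proof -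
    have "0 = E p x"
      by (simp only: p(2) zero_fun_apply)
    also have "\<dots> = (\<Sum>i\<le>Suc (degree q). (coeff (pCons 0 q) i - a * coeff q i) * (?T ^^ i) f x)"
      unfolding E_def deg by (intro sum.cong refl) (simp add: arg_cong[OF q, of coeff])
    also have "\<dots> = (\<Sum>i\<le>Suc (degree q). coeff (pCons 0 q) i * (?T ^^ i) f x)
                  - a * (\<Sum>i\<le>Suc (degree q). coeff q i * (?T ^^ i) f x)"
      by (simp add: algebra_simps sum_subtractf sum_distrib_left del: sum.atMost_Suc)
    also have "(\<Sum>i\<le>Suc (degree q). coeff (pCons 0 q) i * (?T ^^ i) f x)
        = (\<Sum>i\<le>degree q. coeff q i * ?T ((?T ^^ i) f) x)"
      by (subst sum.atMost_Suc_shift) simp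
    also have "\<dots> = ?T (E q) x"
      unfolding E_def kernel_op_sum ..
    also have "(\<Sum>i\<le>Suc (degree q). coeff q i * (?T ^^ i) f x) = E q x"
      by (simp add: E_def coeff_eq_0)
    finally show ?thesis by simp
  qed
  ultimately show ?thesis using that[of "E q" a] by simp
qed

lemma inner_on_commute: "inner_on S g f = cnj (inner_on S f g)"
  by (simp add: inner_on_def mult.commute)

lemma inner_on_self: "inner_on S f f = complex_of_real (\<Sum>x\<in>S. (cmod (f x))\<^sup>2)"
  by (simp only: inner_on_def complex_norm_square of_real_sum)

lemma inner_on_self_pos:
  assumes "finite S" "supported S f" "f \<noteq> 0"
  shows "(\<Sum>x\<in>S. (cmod (f x))\<^sup>2) > 0"
proof -
  obtain x where "f x \<noteq> 0" using assms(3) by (auto simp: fun_eq_iff)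
  with assms(2) have "x \<in> S" by (auto simp: supported_def)
  then have "(cmod (f x))\<^sup>2 \<le> (\<Sum>x\<in>S. (cmod (f x))\<^sup>2)"
    using assms(1) by (intro member_le_sum) auto
  with \<open>f x \<noteq> 0\<close> show ?thesis
    by (smt (verit) norm_eq_zero zero_less_power2)
qed

lemma inner_on_sum_left:
  "inner_on S (\<lambda>x. \<Sum>i\<in>I. c i * f i x) g = (\<Sum>i\<in>I. c i * inner_on S (f i) g)"
  unfolding inner_on_def sum_distrib_left sum_distrib_right mult.assoc by (rule sum.swap)

lemma kernel_op_selfadjoint:
  assumes "\<And>x y. K y x = cnj (K x y)"
  shows "inner_on S (kernel_op S K f) g = inner_on S f (kernel_op S K g)"
proof -
  have "inner_on S (kernel_op S K f) g = (\<Sum>x\<in>S. \<Sum>y\<in>S. K x y * f y * cnj (g x))"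
    by (simp add: inner_on_def kernel_op_def sum_distrib_right)
  also have "\<dots> = (\<Sum>y\<in>S. \<Sum>x\<in>S. K x y * f y * cnj (g x))"
    by (rule sum.swap)
  also have "\<dots> = (\<Sum>y\<in>S. \<Sum>x\<in>S. f y * cnj (K y x * g x))"
    by (intro sum.cong refl) (subst assms, simp)
  also have "\<dots> = inner_on S f (kernel_op S K g)"
    by (simp add: inner_on_def kernel_op_def sum_distrib_left)
  finally show ?thesis .
qed

definition orthonormal_on :: "'a set \<Rightarrow> nat \<Rightarrow> (nat \<Rightarrow> 'a \<Rightarrow> complex) \<Rightarrow> bool" where
  "orthonormal_on S n \<phi> \<longleftrightarrow> (\<forall>i<n. supported S (\<phi> i)) \<and>
     (\<forall>i<n. \<forall>j<n. inner_on S (\<phi> i) (\<phi> j) = (if i = j then 1 else 0))"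

text \<open>The residue of the point mass at \<open>x\<close> after projecting away the \<open>\<phi> i\<close>.\<close>

definition residue_at :: "nat \<Rightarrow> (nat \<Rightarrow> 'a \<Rightarrow> complex) \<Rightarrow> 'a \<Rightarrow> 'a \<Rightarrow> complex" where
  "residue_at n \<phi> x = (\<lambda>y. (if y = x then 1 else 0) - (\<Sum>i<n. cnj (\<phi> i x) * \<phi> i y))"

text \<open>The coefficient of the point mass at \<open>x\<close> along \<open>\<phi> i\<close> is \<open>cnj (\<phi> i x)\<close>, and exactly
  this part has been subtracted.\<close>

lemma residue_at_orthogonal:
  assumes "finite S" "orthonormal_on S n \<phi>" "x \<in> S" "j < n"
  shows "inner_on S (residue_at n \<phi> x) (\<phi> j) = 0"
proof -
  have "inner_on S (residue_at n \<phi> x) (\<phi> j)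
      = inner_on S (\<lambda>y. if y = x then 1 else 0) (\<phi> j)
        - inner_on S (\<lambda>y. \<Sum>i<n. cnj (\<phi> i x) * \<phi> i y) (\<phi> j)"
    unfolding inner_on_def residue_at_def by (simp add: left_diff_distrib sum_subtractf)
  also have "inner_on S (\<lambda>y. if y = x then 1 else 0) (\<phi> j)
      = (\<Sum>y\<in>S. if y = x then cnj (\<phi> j x) else 0)"
    unfolding inner_on_def by (intro sum.cong) auto
  also have "\<dots> = cnj (\<phi> j x)"
    using assms by simp
  also have "inner_on S (\<lambda>y. \<Sum>i<n. cnj (\<phi> i x) * \<phi> i y) (\<phi> j)
      = (\<Sum>i<n. cnj (\<phi> i x) * (if i = j then 1 else 0))"
    unfolding inner_on_sum_left using assms by (intro sum.cong) (auto simp: orthonormal_on_def)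
  also have "\<dots> = cnj (\<phi> j x)"
    using assms(4) by (simp add: if_distrib[of "\<lambda>z. _ * z"] cong: if_cong)
  finally show ?thesis by simp
qed

lemma residue_at_supported:
  assumes "orthonormal_on S n \<phi>" "x \<in> S"
  shows "supported S (residue_at n \<phi> x)"
  using assms by (auto simp: supported_def residue_at_def orthonormal_on_def)

text \<open>Since the residue \<open>r\<close> is orthogonal to every \<open>\<phi> i\<close>, its squared norm is its inner product with
  the point mass, that is, \<open>r x\<close>.\<close>

lemma residue_at_norm:
  assumes "finite S" "orthonormal_on S n \<phi>" "x \<in> S"
  shows "(\<Sum>y\<in>S. (cmod (residue_at n \<phi> x y))\<^sup>2) = 1 - (\<Sum>i<n. (cmod (\<phi> i x))\<^sup>2)"
proof -
  let ?r = "residue_at n \<phi> x"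
  have "complex_of_real (\<Sum>y\<in>S. (cmod (?r y))\<^sup>2) = cnj (inner_on S ?r ?r)"
    by (simp add: inner_on_self)
  also have "\<dots> = inner_on S ?r (\<lambda>y. if y = x then 1 else 0) 
       - cnj (inner_on S (\<lambda>y. \<Sum>i<n. cnj (\<phi> i x) * \<phi> i y) ?r)"
  proof -
    have "inner_on S f ?r = inner_on S f (\<lambda>y. if y = x then 1 else 0)
        - cnj (inner_on S (\<lambda>y. \<Sum>i<n. cnj (\<phi> i x) * \<phi> i y) f)" for f
      by (simp add: inner_on_def residue_at_def right_diff_distrib sum_subtractf mult.commute)
    then show ?thesis
      using inner_on_commute[of S ?r ?r] by simp
  qed
  also have "inner_on S (\<lambda>y. \<Sum>i<n. cnj (\<phi> i x) * \<phi> i y) ?r = 0"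
    unfolding inner_on_sum_left
    using residue_at_orthogonal[OF assms] by (subst inner_on_commute) simp
  also have "inner_on S ?r (\<lambda>y. if y = x then 1 else 0) = (\<Sum>y\<in>S. if y = x then ?r x else 0)"
    unfolding inner_on_def by (intro sum.cong) auto
  also have "\<dots> = ?r x"
    using assms by simp
  also have "\<dots> = complex_of_real (1 - (\<Sum>i<n. (cmod (\<phi> i x))\<^sup>2))"
    by (simp add: residue_at_def mult.commute flip: complex_norm_square)
  finally show ?thesis
    by (simp only: of_real_eq_iff complex_cnj_zero diff_zero)
qed

lemma orthonormal_sum_norms:
  assumes "orthonormal_on S n \<phi>" "i < n"
  shows "(\<Sum>x\<in>S. (cmod (\<phi> i x))\<^sup>2) = 1"
proof -
  have "complex_of_real (\<Sum>x\<in>S. (cmod (\<phi> i x))\<^sup>2) = 1"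
    using assms inner_on_self[of S "\<phi> i"] by (simp add: orthonormal_on_def)
  then show ?thesis using of_real_eq_1_iff by blast
qed

text \<open>This replaces a dimension count: fewer than \<open>card S\<close> orthonormal functions leave a nonzero
  residue, and exactly \<open>card S\<close> of them leave none.\<close>

lemma residue_at_total:
  assumes "finite S" "orthonormal_on S n \<phi>"
  shows "(\<Sum>x\<in>S. \<Sum>y\<in>S. (cmod (residue_at n \<phi> x y))\<^sup>2) = real (card S) - real n"
proof -
  have "(\<Sum>x\<in>S. \<Sum>y\<in>S. (cmod (residue_at n \<phi> x y))\<^sup>2) = (\<Sum>x\<in>S. 1 - (\<Sum>i<n. (cmod (\<phi> i x))\<^sup>2))"
    using assms by (intro sum.cong refl residue_at_norm)
  also have "\<dots> = real (card S) - (\<Sum>i<n. \<Sum>x\<in>S. (cmod (\<phi> i x))\<^sup>2)"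
    by (simp add: sum_subtractf sum.swap[of _ S])
  also have "\<dots> = real (card S) - real n"
    using orthonormal_sum_norms[OF assms(2)] by simp
  finally show ?thesis .
qed

text \<open>As many orthonormal functions as points leave residues of total squared norm \<open>0\<close>, so every
  point mass is its own projection.\<close>

lemma orthonormal_complete:
  assumes "finite S" "orthonormal_on S (card S) \<phi>" "x \<in> S"
  shows "(\<Sum>i<card S. cnj (\<phi> i x) * \<phi> i y) = (if y = x then 1 else 0)"
proof -
  have "supported S (residue_at (card S) \<phi> x)"
    by (rule residue_at_supported[OF assms(2,3)])
  moreover have "(\<Sum>y\<in>S. (cmod (residue_at (card S) \<phi> x y))\<^sup>2) = 0"
    using residue_at_total[OF assms(1,2)] assms(1,3)
    by (simp add: sum_nonneg_eq_0_iff sum_nonneg)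
  ultimately have "residue_at (card S) \<phi> x = 0"
    using inner_on_self_pos[OF assms(1), of "residue_at (card S) \<phi> x"] by fastforce
  then have "residue_at (card S) \<phi> x y = 0" by simp
  then show ?thesis by (simp add: residue_at_def)
qed

lemma orthonormal_expansion:
  assumes "finite S" "orthonormal_on S (card S) \<phi>" "supported S f"
  shows "f y = (\<Sum>i<card S. inner_on S f (\<phi> i) * \<phi> i y)"
proof -
  have "(\<Sum>i<card S. inner_on S f (\<phi> i) * \<phi> i y) = (\<Sum>x\<in>S. f x * (\<Sum>i<card S. cnj (\<phi> i x) * \<phi> i y))"
    unfolding inner_on_def sum_distrib_left sum_distrib_right mult.assoc by (rule sum.swap)
  also have "\<dots> = (\<Sum>x\<in>S. if y = x then f x else 0)"
    using orthonormal_complete[OF assms(1,2)] by (intro sum.cong) auto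
  also have "\<dots> = f y"
    using assms(1,3) by (auto simp: supported_def)
  finally show ?thesis by simp
qed

lemma orthonormal_parseval:
  assumes "finite S" "orthonormal_on S (card S) \<phi>"
  shows "(\<Sum>i<card S. (cmod (inner_on S f (\<phi> i)))\<^sup>2) = (\<Sum>x\<in>S. (cmod (f x))\<^sup>2)"
proof -
  define f' where "f' = (\<lambda>x. if x \<in> S then f x else 0)"
  have f': "inner_on S f' g = inner_on S f g" "inner_on S g f' = inner_on S g f" for g
    by (auto simp: inner_on_def f'_def)
  have "complex_of_real (\<Sum>x\<in>S. (cmod (f x))\<^sup>2) = inner_on S f' f'"
    by (simp only: f' inner_on_self[symmetric])
  also have "\<dots> = inner_on S (\<lambda>y. \<Sum>i<card S. inner_on S f' (\<phi> i) * \<phi> i y) f'"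
  proof (rule arg_cong[where f = "\<lambda>h. inner_on S h f'"])
    have "supported S f'" by (simp add: f'_def supported_def)
    then show "f' = (\<lambda>y. \<Sum>i<card S. inner_on S f' (\<phi> i) * \<phi> i y)"
      by (intro ext orthonormal_expansion[OF assms])
  qed
  also have "\<dots> = (\<Sum>i<card S. inner_on S f (\<phi> i) * inner_on S (\<phi> i) f)"
    by (simp add: inner_on_sum_left f')
  also have "\<dots> = complex_of_real (\<Sum>i<card S. (cmod (inner_on S f (\<phi> i)))\<^sup>2)"
    by (subst (2) inner_on_commute) (simp only: complex_norm_square of_real_sum)
  finally show ?thesis by (simp only: of_real_eq_iff)
qed

text \<open>The orthonormal eigenfunctions are produced one at a time: while there are fewer than \<open>card S\<close>,
  some residue spans a nonzero part of their orthogonal complement, which is invariant because the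
  operator is self-adjoint, and so contains a further eigenfunction.\<close>

theorem hermitian_kernel_spectral:
  assumes S: "finite S" and K: "\<And>x y. K y x = cnj (K x y)"
  obtains \<phi> \<mu> where "orthonormal_on S (card S) \<phi>"
    "\<And>i x. i < card S \<Longrightarrow> kernel_op S K (\<phi> i) x = complex_of_real (\<mu> i) * \<phi> i x"
proof -
  have "\<exists>\<phi> \<mu>. orthonormal_on S n \<phi> \<and>
      (\<forall>i<n. \<forall>x. kernel_op S K (\<phi> i) x = complex_of_real (\<mu> i) * \<phi> i x)" if "n \<le> card S" for n
    using that
  proof (induction n)
    case 0
    show ?case by (simp add: orthonormal_on_def)
  next
    case (Suc n)
    then obtain \<phi> \<mu> where on: "orthonormal_on S n \<phi>"
      and ev: "\<And>i x. i < n \<Longrightarrow> kernel_op S K (\<phi> i) x = complex_of_real (\<mu> i) * \<phi> i x"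
      by auto
    define W where "W = {f. supported S f \<and> (\<forall>i<n. inner_on S f (\<phi> i) = 0)}"
    have "\<exists>x\<in>S. residue_at n \<phi> x \<noteq> 0"
    proof (rule ccontr)
      assume "\<not> ?thesis"
      then have "(\<Sum>x\<in>S. \<Sum>y\<in>S. (cmod (residue_at n \<phi> x y))\<^sup>2) = 0" by simp
      with residue_at_total[OF S on] Suc.prems show False by simp
    qed
    then obtain x where x: "x \<in> S" "residue_at n \<phi> x \<noteq> 0" by blast
    have fW: "residue_at n \<phi> x \<in> W"
      using residue_at_orthogonal[OF S on x(1)] residue_at_supported[OF on x(1)] by (simp add: W_def)
    have "cfun.subspace W"
      by (auto simp: cfun.subspace_def W_def supported_def inner_on_def distrib_right sum.distrib mult.assoc
          simp flip: sum_distrib_left)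
    moreover have "kernel_op S K f \<in> W" if "f \<in> W" for f
    proof -
      have "inner_on S (kernel_op S K f) (\<phi> i) = 0" if "i < n" for i
      proof -
        have "inner_on S (kernel_op S K f) (\<phi> i) = inner_on S f (\<lambda>x. complex_of_real (\<mu> i) * \<phi> i x)"
          unfolding kernel_op_selfadjoint[OF K] using ev[OF that] by (simp add: inner_on_def)
        also have "\<dots> = complex_of_real (\<mu> i) * inner_on S f (\<phi> i)"
          by (simp add: inner_on_def sum_distrib_left mult_ac)
        finally show ?thesis using \<open>f \<in> W\<close> that by (simp add: W_def)
      qed
      then show ?thesis by (simp add: W_def)
    qed
    moreover have "supported S f" if "f \<in> W" for f
      using that by (simp add: W_def)
    ultimately obtain g c where g: "g \<in> W" "g \<noteq> 0" "\<And>x. kernel_op S K g x = c * g x"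
      using kernel_op_eigenvector[OF S _ _ _ fW x(2)] by metis
    \<comment> \<open>self-adjointness makes the eigenvalue real; the eigenfunction is then normalised\<close>
  define N where "N = (\<Sum>x\<in>S. (cmod (g x))\<^sup>2)"
    have N: "N > 0" "inner_on S g g = complex_of_real N"
      using inner_on_self_pos[OF S] g by (auto simp: N_def W_def inner_on_self)
    have "c * inner_on S g g = inner_on S (kernel_op S K g) g"
      using g(3) by (simp add: inner_on_def sum_distrib_left mult_ac)
    also have "\<dots> = inner_on S g (kernel_op S K g)"
      by (rule kernel_op_selfadjoint[OF K])
    also have "\<dots> = cnj c * inner_on S g g"
      using g(3) by (simp add: inner_on_def sum_distrib_left mult_ac)
    finally have "c = cnj c" using N by auto
    then have c: "c = complex_of_real (Re c)"
      by (metis Reals_cnj_iff complex_is_Real_iff of_real_Re)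
    define h where "h = (\<lambda>x. g x / complex_of_real (sqrt N))"
    have hg: "inner_on S h f = inner_on S g f / complex_of_real (sqrt N)"
      "inner_on S f h = inner_on S f g / complex_of_real (sqrt N)" for f
      by (simp_all add: h_def inner_on_def sum_divide_distrib)
    have "orthonormal_on S (Suc n) (\<phi>(n := h))"
      unfolding orthonormal_on_def
    proof (intro conjI allI impI)
      fix i assume "i < Suc n"
      then show "supported S ((\<phi>(n := h)) i)"
        using on g(1) by (auto simp: orthonormal_on_def W_def h_def supported_def)
    next
      have 1: "inner_on S h h = 1"
        using N by (simp add: hg flip: of_real_mult)
      have 2: "inner_on S h (\<phi> i) = 0" "inner_on S (\<phi> i) h = 0" if "i < n" for i
        using g(1) that inner_on_commute[of S "\<phi> i" g] by (auto simp: W_def hg)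
      fix i j assume "i < Suc n" "j < Suc n"
      then show "inner_on S ((\<phi>(n := h)) i) ((\<phi>(n := h)) j) = (if i = j then 1 else 0)"
        using on 1 2 by (auto simp: orthonormal_on_def less_Suc_eq)
    qed
    moreover have "kernel_op S K h x = complex_of_real (Re c) * h x" for x
    proof -
      have "kernel_op S K h x = kernel_op S K g x / complex_of_real (sqrt N)"
        by (simp add: h_def kernel_op_def sum_divide_distrib)
      then show ?thesis using g(3) c by (simp add: h_def)
    qed
    ultimately show ?case
      using ev by (intro exI[of _ "\<phi>(n := h)"] exI[of _ "\<mu>(n := Re c)"]) 
        (auto simp: less_Suc_eq simp flip: fun_upd_def)
  qed
  from this[of "card S"] show ?thesis using that by auto
qed

text \<open>The quadratic form in the eigenbasis. The function \<open>f\<close> may be nonzero outside \<open>S\<close>, as plane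
  waves are; only its values on \<open>S\<close> enter.\<close>

lemma inner_on_kernel_op_spectral:
  assumes S: "finite S" and on: "orthonormal_on S (card S) \<phi>"
    and ev: "\<And>i x. i < card S \<Longrightarrow> kernel_op S K (\<phi> i) x = complex_of_real (\<mu> i) * \<phi> i x"
  shows "inner_on S (kernel_op S K f) f = complex_of_real (\<Sum>i<card S. \<mu> i * (cmod (inner_on S f (\<phi> i)))\<^sup>2)"
proof -
  define f' where "f' = (\<lambda>x. if x \<in> S then f x else 0)"
  have f': "inner_on S f' g = inner_on S f g" for g
    by (auto simp: inner_on_def f'_def)
  have "supported S f'" by (simp add: f'_def supported_def)
  then have expand: "f' = (\<lambda>y. \<Sum>i<card S. inner_on S f (\<phi> i) * \<phi> i y)"
    using orthonormal_expansion[OF S on, of f'] by (auto simp: f' fun_eq_iff)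
  have "kernel_op S K f = kernel_op S K f'"
    by (simp add: kernel_op_def f'_def fun_eq_iff)
  also have "\<dots> = (\<lambda>x. \<Sum>i<card S. inner_on S f (\<phi> i) * kernel_op S K (\<phi> i) x)"
    by (subst expand) (rule kernel_op_sum)
  also have "\<dots> = (\<lambda>x. \<Sum>i<card S. (complex_of_real (\<mu> i) * inner_on S f (\<phi> i)) * \<phi> i x)"
    by (simp add: ev mult_ac)
  finally have "inner_on S (kernel_op S K f) f
      = (\<Sum>i<card S. complex_of_real (\<mu> i) * inner_on S f (\<phi> i) * inner_on S (\<phi> i) f)"
    by (simp only: inner_on_sum_left)
  also have "\<dots> = (\<Sum>i<card S. complex_of_real (\<mu> i * (cmod (inner_on S f (\<phi> i)))\<^sup>2))"
    by (intro sum.cong refl) (subst (2) inner_on_commute, simp only: of_real_mult complex_norm_square mult.assoc)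
  finally show ?thesis by simp
qed

lemma orthonormal_inj:
  assumes "orthonormal_on S n \<phi>"
  shows "inj_on \<phi> {..<n}"
proof (rule inj_onI)
  fix i j assume ij: "i \<in> {..<n}" "j \<in> {..<n}" "\<phi> i = \<phi> j"
  have "inner_on S (\<phi> i) (\<phi> j) = (if i = j then 1 else 0)"
    using assms ij(1,2) by (simp add: orthonormal_on_def)
  moreover have "inner_on S (\<phi> i) (\<phi> j) = 1"
    unfolding ij(3) using assms ij(2) by (simp add: orthonormal_on_def)
  ultimately show "i = j" by (simp split: if_splits)
qed

lemma orthonormal_independent:
  assumes on: "orthonormal_on S n \<phi>" and I: "I \<subseteq> {..<n}"
  shows "cfun.independent (\<phi> ` I)"
proof
  assume "cfun.dependent (\<phi> ` I)"
  have fin: "finite I" using I finite_subset by blast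
  have inj: "inj_on \<phi> I" using orthonormal_inj[OF on] I inj_on_subset by blast
  obtain u j where u: "(\<Sum>f\<in>\<phi> ` I. (\<lambda>x. u f * f x)) = 0" and j: "j \<in> I" "u (\<phi> j) \<noteq> 0"
    using \<open>cfun.dependent (\<phi> ` I)\<close> fin by (subst (asm) cfun.dependent_finite) auto
  have "0 = (\<Sum>i\<in>I. u (\<phi> i) * \<phi> i x)" for x
    using fun_cong[OF u, of x] inj by (simp add: sum_fun_apply sum.reindex)
  then have "inner_on S (\<lambda>x. \<Sum>i\<in>I. u (\<phi> i) * \<phi> i x) (\<phi> j) = inner_on S (\<lambda>x. 0) (\<phi> j)"
    by simp
  then have "0 = (\<Sum>i\<in>I. u (\<phi> i) * inner_on S (\<phi> i) (\<phi> j))"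
    unfolding inner_on_sum_left by (simp add: inner_on_def)
  also have "\<dots> = (\<Sum>i\<in>I. if i = j then u (\<phi> j) else 0)"
    using on I j by (intro sum.cong refl) (auto simp: orthonormal_on_def subset_iff)
  also have "\<dots> = u (\<phi> j)"
    using fin j by simp
  finally show False using j by simp
qed

section \<open>Walks and the kernel coefficients\<close>

lemma adj_commute: "adj x y \<longleftrightarrow> adj y x"
proof -
  have "adj y x" if "adj x y" for x y :: "int ^ 'd"
  proof -
    obtain i where i: "x - y \<in> {axis i 1, - axis i 1}"
      using \<open>adj x y\<close> unfolding adj_def by blast
    have "y - x = - (x - y)" by simp
    with i have "y - x \<in> {axis i 1, - axis i 1}" by fastforce
    then show ?thesis unfolding adj_def by blast
  qed
  then show ?thesis by blast
qed

lemma walks_0: "walks 0 x y = (if x = y then {[x]} else {})"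
  by (auto simp: walks_def length_Suc_conv)

text \<open>Splitting off the first step rather than the last keeps the target fixed, so that inductions on
  the length generalise over the source only.\<close>

lemma walks_Suc: "walks (Suc m) x y = (\<Union>w\<in>{w. adj x w}. (#) x ` walks m w y)"
proof (intro equalityI subsetI)
  fix z assume z: "z \<in> walks (Suc m) x y"
  then obtain z' where z': "z = x # z'"
    by (cases z) (auto simp: walks_def)
  with z have adj: "\<forall>i<Suc m. adj ((x # z') ! i) (z' ! i)" by (auto simp: walks_def)
  have "adj x (z' ! 0)" using adj[rule_format, of 0] by simp
  moreover have "adj (z' ! i) (z' ! Suc i)" if "i < m" for i
    using adj[rule_format, of "Suc i"] that by simp
  ultimately show "z \<in> (\<Union>w\<in>{w. adj x w}. (#) x ` walks m w y)"
    using z z' by (auto simp: walks_def)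
next
  fix z assume "z \<in> (\<Union>w\<in>{w. adj x w}. (#) x ` walks m w y)"
  then show "z \<in> walks (Suc m) x y"
    by (auto simp: walks_def nth_Cons split: nat.splits)
qed

lemma finite_walks: "finite (walks m x y)"
  by (induction m arbitrary: x) (auto simp: walks_0 walks_Suc finite_neighbours)

lemma card_walks_Suc: "card (walks (Suc m) x y) = (\<Sum>w\<in>{w. adj x w}. card (walks m w y))"
  unfolding walks_Suc
proof (subst card_UN_disjoint)
  show "\<forall>w\<in>{w. adj x w}. \<forall>w'\<in>{w. adj x w}. w \<noteq> w' \<longrightarrow>
      (#) x ` walks m w y \<inter> (#) x ` walks m w' y = {}"
    by (auto simp: walks_def)
qed (auto simp: finite_neighbours finite_walks card_image)

lemma walks_rev: "z \<in> walks m x y \<Longrightarrow> rev z \<in> walks m y x"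
proof -
  assume z: "z \<in> walks m x y"
  have "adj (rev z ! i) (rev z ! Suc i)" if "i < m" for i
  proof -
    have "adj (z ! (m - Suc i)) (z ! Suc (m - Suc i))"
      using z that by (auto simp: walks_def)
    moreover have "Suc (m - Suc i) = m - i" using that by simp
    ultimately show ?thesis
      using z that by (subst adj_commute) (simp add: rev_nth walks_def)
  qed
  moreover have "length z = Suc m" "rev z ! 0 = y" "rev z ! m = x"
    using z by (auto simp: walks_def rev_nth)
  ultimately show ?thesis by (simp add: walks_def)
qed

lemma card_walks_commute: "card (walks m x y) = card (walks m y x)"
proof -
  have "rev ` walks m y x = walks m x y"
    using walks_rev by (force intro: rev_image_eqI)
  then show ?thesis
    by (metis card_image inj_on_rev)
qed

lemma coeff_a_commute: "coeff_a l x y = coeff_a l y x"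
  by (simp add: coeff_a_def lattice_deg_eq card_walks_commute)

lemma sum_card_walks_le:
  fixes x :: "int ^ 'd::finite"
  assumes "finite Y"
  shows "(\<Sum>y\<in>Y. card (walks m x y)) \<le> (2 * CARD('d)) ^ m"
proof (induction m arbitrary: x)
  case 0
  then show ?case using assms by (simp add: walks_0 sum.If_cases if_distrib cong: if_cong)
next
  case (Suc m)
  have "(\<Sum>y\<in>Y. card (walks (Suc m) x y)) = (\<Sum>w\<in>{w. adj x w}. \<Sum>y\<in>Y. card (walks m w y))"
    unfolding card_walks_Suc by (rule sum.swap)
  also have "\<dots> \<le> (\<Sum>w\<in>{w. adj x w}. (2 * CARD('d)) ^ m)"
    by (intro sum_mono Suc.IH)
  also have "\<dots> = (2 * CARD('d)) ^ Suc m"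
    using lattice_deg_eq[of x] by (simp add: lattice_deg_def)
  finally show ?case .
qed

text \<open>Taking absolute values turns the kernel of \<open>(deg - adjacency) ^ l\<close> into that of
  \<open>(deg + adjacency) ^ l\<close>, whose row sums are \<open>(2 deg) ^ l\<close>.\<close>

lemma sum_abs_coeff_a_le:
  fixes x :: "int ^ 'd::finite"
  assumes "finite Y"
  shows "(\<Sum>y\<in>Y. \<bar>coeff_a l x y\<bar>) \<le> 4 ^ l * real CARD('d) ^ l"
proof -
  let ?D = "2 * real CARD('d)"
  have "(\<Sum>y\<in>Y. \<bar>coeff_a l x y\<bar>)
      \<le> (\<Sum>y\<in>Y. \<Sum>m\<le>l. real (l choose m) * ?D ^ (l - m) * real (card (walks m x y)))"
    unfolding coeff_a_def lattice_deg_eq atMost_atLeast0[symmetric]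
    by (intro sum_mono order_trans[OF sum_abs]) (auto simp: abs_mult)
  also have "\<dots> = (\<Sum>m\<le>l. real (l choose m) * ?D ^ (l - m) * real (\<Sum>y\<in>Y. card (walks m x y)))"
    unfolding of_nat_sum sum_distrib_left by (rule sum.swap)
  also have "\<dots> \<le> (\<Sum>m\<le>l. real (l choose m) * ?D ^ (l - m) * real ((2 * CARD('d)) ^ m))"
    by (intro sum_mono mult_left_mono) (auto simp only: of_nat_le_iff sum_card_walks_le[OF assms] intro!: mult_nonneg_nonneg zero_le_power of_nat_0_le_iff zero_le_numeral)
  also have "\<dots> = (?D + ?D) ^ l"
    by (subst binomial_ring) (simp add: mult_ac)
  also have "?D + ?D = 4 * real CARD('d)" by simp
  also have "\<dots> ^ l = 4 ^ l * real CARD('d) ^ l" by (rule power_mult_distrib)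
  finally show ?thesis .
qed

section \<open>Powers of the Laplacian as kernel operators\<close>

definition neighbour_sum :: "(int ^ 'd::finite \<Rightarrow> complex) \<Rightarrow> int ^ 'd \<Rightarrow> complex" where
  "neighbour_sum f x = (\<Sum>y\<in>{y. adj x y}. f y)"

lemma laplacian_eq: "laplacian f x = neighbour_sum f x - of_nat (2 * CARD('d)) * f x"
  for f :: "int ^ 'd::finite \<Rightarrow> complex"
  using lattice_deg_eq[of x]
  by (simp add: laplacian_def neighbour_sum_def sum_subtractf lattice_deg_def)

text \<open>Pascal's rule for powers of a constant minus a shift.\<close>

lemma binomial_shift:
  fixes u :: "nat \<Rightarrow> 'a::comm_ring_1"
  shows "(\<Sum>m\<le>Suc l. of_nat (Suc l choose m) * (-1) ^ m * c ^ (Suc l - m) * u m) =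
     c * (\<Sum>m\<le>l. of_nat (l choose m) * (-1) ^ m * c ^ (l - m) * u m)
       - (\<Sum>m\<le>l. of_nat (l choose m) * (-1) ^ m * c ^ (l - m) * u (Suc m))"
proof -
  let ?t = "\<lambda>m. of_nat (l choose m) * (-1) ^ m * c ^ (Suc l - m) * u m"
  have "c * (\<Sum>m\<le>l. of_nat (l choose m) * (-1) ^ m * c ^ (l - m) * u m) = (\<Sum>m\<le>l. ?t m)"
    by (simp add: sum_distrib_left Suc_diff_le mult_ac)
  also have "\<dots> = (\<Sum>m\<le>Suc l. ?t m)" by (simp add: binomial_eq_0)
  also have "\<dots> = ?t 0 + (\<Sum>m\<le>l. ?t (Suc m))" by (rule sum.atMost_Suc_shift)
  finally have *: "c * (\<Sum>m\<le>l. of_nat (l choose m) * (-1) ^ m * c ^ (l - m) * u m)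
      = ?t 0 + (\<Sum>m\<le>l. ?t (Suc m))" .
  show ?thesis
    unfolding * by (subst sum.atMost_Suc_shift) (simp add: sum.distrib sum_subtractf sum_negf algebra_simps)
qed

lemma neighbour_sum_linear:
  "neighbour_sum (\<lambda>x. \<Sum>i\<in>I. c i * f i x) = (\<lambda>x. \<Sum>i\<in>I. c i * neighbour_sum (f i) x)"
  by (auto simp: neighbour_sum_def fun_eq_iff sum_distrib_left intro: sum.swap)

text \<open>\<open>- \<Delta>\<close> is the constant degree minus the neighbour sum, and the two commute, so its powers
  are given by the binomial theorem.\<close>

lemma laplacian_power_expand:
  fixes f :: "int ^ 'd::finite \<Rightarrow> complex"
  shows "(-1) ^ l * (laplacian ^^ l) f x =
    (\<Sum>m\<le>l. of_nat (l choose m) * (-1) ^ m * of_nat (2 * CARD('d)) ^ (l - m) * (neighbour_sum ^^ m) f x)"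
proof (induction l arbitrary: x)
  case 0
  show ?case by simp
next
  case (Suc l)
  let ?c = "of_nat (2 * CARD('d)) :: complex"
  let ?a = "\<lambda>m. of_nat (l choose m) * (-1) ^ m * ?c ^ (l - m)"
  have L: "(laplacian ^^ l) f = (\<lambda>x. \<Sum>m\<le>l. ((-1) ^ l * ?a m) * (neighbour_sum ^^ m) f x)"
  proof
    fix x
    have "(laplacian ^^ l) f x = (-1) ^ l * ((-1) ^ l * (laplacian ^^ l) f x)"
      by (simp only: mult.assoc[symmetric] minus_one_mult_self mult_1)
    then show "(laplacian ^^ l) f x = (\<Sum>m\<le>l. ((-1) ^ l * ?a m) * (neighbour_sum ^^ m) f x)"
      by (simp only: Suc.IH sum_distrib_left mult.assoc)
  qed
  have "(-1) ^ Suc l * (laplacian ^^ Suc l) f x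
      = ?c * ((-1) ^ l * (laplacian ^^ l) f x) - (-1) ^ l * neighbour_sum ((laplacian ^^ l) f) x"
    by (simp add: laplacian_eq algebra_simps)
  also have "(-1) ^ l * neighbour_sum ((laplacian ^^ l) f) x
      = (\<Sum>m\<le>l. ((-1) ^ l * (-1) ^ l) * (?a m * (neighbour_sum ^^ Suc m) f x))"
    unfolding L neighbour_sum_linear by (simp add: sum_distrib_left mult_ac)
  also have "\<dots> = (\<Sum>m\<le>l. ?a m * (neighbour_sum ^^ Suc m) f x)"
    by (simp only: minus_one_mult_self mult_1)
  finally show ?case
    unfolding Suc.IH binomial_shift .
qed

lemma neighbour_sum_power:
  fixes f :: "int ^ 'd::finite \<Rightarrow> complex"
  assumes "finite Y" "\<And>y. walks m x y \<noteq> {} \<Longrightarrow> f y \<noteq> 0 \<Longrightarrow> y \<in> Y"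
  shows "(neighbour_sum ^^ m) f x = (\<Sum>y\<in>Y. of_nat (card (walks m x y)) * f y)"
  using assms(2)
proof (induction m arbitrary: x)
  case 0
  then have "x \<in> Y \<or> f x = 0" by (auto simp: walks_0)
  with assms(1) show ?case
    by (auto simp: walks_0 if_distrib[of card] if_distrib[of of_nat] if_distrib[of "\<lambda>z. z * _"] cong: if_cong)
next
  case (Suc m)
  have "(neighbour_sum ^^ Suc m) f x = (\<Sum>w\<in>{w. adj x w}. (neighbour_sum ^^ m) f w)"
    by (simp add: neighbour_sum_def)
  also have "\<dots> = (\<Sum>w\<in>{w. adj x w}. \<Sum>y\<in>Y. of_nat (card (walks m w y)) * f y)"
  proof (intro sum.cong refl Suc.IH)
    fix w y assume "w \<in> {w. adj x w}" "walks m w y \<noteq> {}" "f y \<noteq> 0"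
    then show "y \<in> Y" by (intro Suc.prems) (auto simp: walks_Suc)
  qed
  also have "\<dots> = (\<Sum>y\<in>Y. of_nat (card (walks (Suc m) x y)) * f y)"
    unfolding card_walks_Suc of_nat_sum sum_distrib_right by (rule sum.swap)
  finally show ?case .
qed

lemma finite_walk_targets: "finite {y. walks m x y \<noteq> {}}"
proof (induction m arbitrary: x)
  case (Suc m)
  have "{y. walks (Suc m) x y \<noteq> {}} = (\<Union>w\<in>{w. adj x w}. {y. walks m w y \<noteq> {}})"
    by (auto simp: walks_Suc)
  then show ?case by (simp only: finite_UN_I[OF finite_neighbours Suc.IH])
qed (auto simp: walks_0)

text \<open>The kernel \<open>coeff_a l x\<close> is defined by counting walks, so its support is controlled directly by
  the endpoints of walks and not
  by the least length in \<open>graph_dist\<close>.\<close>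

definition reach :: "nat \<Rightarrow> int ^ 'd::finite \<Rightarrow> (int ^ 'd) set" where
  "reach l x = (\<Union>m\<le>l. {y. walks m x y \<noteq> {}})"

lemma finite_reach: "finite (reach l x)"
  by (simp add: reach_def finite_walk_targets)

lemma reach_subset_graph_ball: "reach l x \<subseteq> graph_ball x l"
proof
  fix y assume "y \<in> reach l x"
  then obtain m where "m \<le> l" "walks m x y \<noteq> {}" by (auto simp: reach_def)
  then show "y \<in> graph_ball x l"
    unfolding graph_ball_def graph_dist_def by (auto intro: Least_le order_trans)
qed

lemma coeff_a_eq_0: "y \<notin> reach l x \<Longrightarrow> coeff_a l x y = 0"
  by (auto simp: reach_def coeff_a_def intro!: sum.neutral)

lemma reach_commute: "y \<in> reach l x \<longleftrightarrow> x \<in> reach l y"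
  using walks_rev by (fastforce simp: reach_def)

text \<open>\<open>Y\<close> is any finite set containing the points that matter, so that the same set can serve
  all \<open>x\<close> at once, and so that \<open>f\<close> may have infinite support.\<close>

lemma laplacian_power_kernel:
  fixes f :: "int ^ 'd::finite \<Rightarrow> complex"
  assumes Y: "finite Y" "\<And>y. y \<in> reach l x \<Longrightarrow> f y \<noteq> 0 \<Longrightarrow> y \<in> Y"
  shows "(-1) ^ l * (laplacian ^^ l) f x = (\<Sum>y\<in>Y. complex_of_real (coeff_a l x y) * f y)"
proof -
  have "(-1) ^ l * (laplacian ^^ l) f x =
    (\<Sum>m\<le>l. of_nat (l choose m) * (-1) ^ m * of_nat (2 * CARD('d)) ^ (l - m) *
      (\<Sum>y\<in>Y. of_nat (card (walks m x y)) * f y))"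
    unfolding laplacian_power_expand using Y
    by (intro sum.cong refl arg_cong2[of _ _ _ _ "(*)"] neighbour_sum_power) (auto simp: reach_def)
  also have "\<dots> = (\<Sum>y\<in>Y. \<Sum>m\<le>l. of_nat (l choose m) * (-1) ^ m * of_nat (2 * CARD('d)) ^ (l - m) *
      (of_nat (card (walks m x y)) * f y))"
    unfolding sum_distrib_left by (rule sum.swap)
  also have "\<dots> = (\<Sum>y\<in>Y. complex_of_real (coeff_a l x y) * f y)"
    by (simp add: coeff_a_def lattice_deg_eq atMost_atLeast0 sum_distrib_right mult.assoc)
  finally show ?thesis .
qed

section \<open>Boundary layers\<close>

text \<open>Along a walk that starts in \<open>\<Omega>\<close> each step leaves the union of \<open>\<Omega>\<close> and the layers
  built so far only into the next layer.\<close>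

lemma boundary_layer_reach:
  assumes "x \<in> \<Omega>" "y \<in> reach l x" "y \<notin> \<Omega>"
  shows "y \<in> (\<Union>i\<in>{1..l}. boundary_layer i \<Omega>)"
proof -
  have "y \<in> \<Omega> \<union> (\<Union>i\<in>{1..m}. boundary_layer i \<Omega>)" if "walks m y x \<noteq> {}" for m y
    using that
  proof (induction m arbitrary: y)
    case 0
    then show ?case using assms(1) by (auto simp: walks_0 split: if_splits)
  next
    case (Suc m)
    then obtain w where w: "adj y w" "walks m w x \<noteq> {}" by (auto simp: walks_Suc)
    let ?U = "\<Omega> \<union> (\<Union>i\<in>{1..<Suc m}. boundary_layer i \<Omega>)"
    from Suc.IH[OF w(2)] have "w \<in> ?U" by (simp add: atLeastLessThanSuc_atLeastAtMost)
    then have "y \<in> ?U \<union> vertex_boundary ?U" using w(1) by (auto simp: vertex_boundary_def)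
    moreover have "boundary_layer (Suc m) \<Omega> = vertex_boundary ?U"
      by (rule boundary_layer.simps)
    ultimately have "y \<in> ?U \<union> boundary_layer (Suc m) \<Omega>" by simp
    moreover have "{1..Suc m} = insert (Suc m) {1..<Suc m}" by auto
    ultimately show ?case by auto
  qed
  moreover obtain m where "m \<le> l" "walks m x y \<noteq> {}" using assms(2) by (auto simp: reach_def)
  moreover from this have "walks m y x \<noteq> {}" using walks_rev by fastforce
  ultimately show ?thesis using assms(3) by fastforce
qed

lemma finite_vertex_boundary: "finite A \<Longrightarrow> finite (vertex_boundary A)"
  by (rule finite_subset[of _ "\<Union>x\<in>A. {y. adj x y}"])
     (auto simp: vertex_boundary_def finite_neighbours adj_commute)

lemma finite_boundary_layer: "finite \<Omega> \<Longrightarrow> finite (boundary_layer i \<Omega>)"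
proof (induction i rule: less_induct)
  case (less i)
  then show ?case
    by (subst boundary_layer.simps) (auto intro!: finite_vertex_boundary)
qed

lemma boundary_size_le:
  fixes \<Omega> :: "(int ^ 'd::finite) set"
  assumes "finite \<Omega>"
  shows "boundary_size l \<Omega> \<le> 4 ^ l * real CARD('d) ^ l * (\<Sum>i=1..l. real (card (boundary_layer i \<Omega>)))"
proof -
  let ?L = "\<Union>i\<in>{1..l}. boundary_layer i \<Omega>"
  have "boundary_size l \<Omega> \<le> (\<Sum>x\<in>?L. 4 ^ l * real CARD('d) ^ l)"
    unfolding boundary_size_def using assms by (intro sum_mono sum_abs_coeff_a_le) auto
  also have "\<dots> = 4 ^ l * real CARD('d) ^ l * real (card ?L)"
    by simp
  also have "card ?L \<le> (\<Sum>i=1..l. card (boundary_layer i \<Omega>))"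
    by (intro card_UN_le) auto
  finally show ?thesis
    by (simp add: mult_left_mono)
qed

text \<open>The absolute values of the entries that leave \<open>\<Omega>\<close>, counted from the outside. The walk
  argument above puts the outer ends into the first \<open>l\<close> layers, and \<open>boundary_size\<close> sums
  over all of those.\<close>

lemma boundary_size_ge:
  assumes "finite \<Omega>" "finite Y" "Y \<inter> \<Omega> = {}"
  shows "(\<Sum>y\<in>Y. \<Sum>x\<in>\<Omega>. \<bar>coeff_a l x y\<bar>) \<le> boundary_size l \<Omega>"
proof -
  let ?L = "\<Union>i\<in>{1..l}. boundary_layer i \<Omega>"
  have "finite ?L" using finite_boundary_layer[OF assms(1)] by auto
  have "(\<Sum>y\<in>Y. \<Sum>x\<in>\<Omega>. \<bar>coeff_a l x y\<bar>) = (\<Sum>y\<in>Y \<inter> ?L. \<Sum>x\<in>\<Omega>. \<bar>coeff_a l x y\<bar>)"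
    using boundary_layer_reach[of _ \<Omega>] assms coeff_a_eq_0
    by (intro sum.mono_neutral_right) (auto intro!: sum.neutral, blast)
  also have "\<dots> \<le> (\<Sum>y\<in>?L. \<Sum>x\<in>\<Omega>. \<bar>coeff_a l x y\<bar>)"
    using \<open>finite ?L\<close> by (intro sum_mono2) (auto intro: sum_nonneg)
  also have "\<dots> = boundary_size l \<Omega>"
    unfolding boundary_size_def
  proof (rule sum.cong[OF refl])
    fix y
    have "(\<Sum>x\<in>\<Omega>. \<bar>coeff_a l x y\<bar>) = (\<Sum>x\<in>graph_ball y l \<inter> \<Omega>. \<bar>coeff_a l x y\<bar>)"
      using reach_subset_graph_ball[of l y] assms(1) coeff_a_eq_0[of y l] reach_commute[of y l]
      by (intro sum.mono_neutral_right) auto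
    then show "(\<Sum>x\<in>\<Omega>. \<bar>coeff_a l x y\<bar>) = (\<Sum>x\<in>graph_ball y l \<inter> \<Omega>. \<bar>coeff_a l y x\<bar>)"
      by (simp add: coeff_a_commute[of l y])
  qed
  finally show ?thesis .
qed

section \<open>The Dirichlet eigenvalues in terms of an orthonormal eigenbasis\<close>

lemma zero_ext_supported: "supported \<Omega> f \<Longrightarrow> zero_ext \<Omega> f = f"
  by (auto simp: zero_ext_def supported_def fun_eq_iff)

lemma dirichlet_poly_laplace_kernel:
  assumes "finite \<Omega>" "supported \<Omega> f"
  shows "(-1) ^ l * dirichlet_poly_laplace l \<Omega> f x
    = kernel_op \<Omega> (\<lambda>x y. complex_of_real (coeff_a l x y)) f x"
  using laplacian_power_kernel[OF assms(1), of l x f] assms(2)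
  by (auto simp: dirichlet_poly_laplace_def zero_ext_supported[OF assms(2)] kernel_op_def zero_ext_def[of \<Omega> "_ f"] supported_def)

lemma dirichlet_eigenspace_eq:
  assumes "finite \<Omega>"
  shows "dirichlet_eigenspace l \<Omega> t = {f. supported \<Omega> f \<and>
    (\<forall>x. kernel_op \<Omega> (\<lambda>x y. complex_of_real (coeff_a l x y)) f x = complex_of_real t * f x)}"
proof -
  have "(\<forall>x\<in>\<Omega>. (-1) ^ l * dirichlet_poly_laplace l \<Omega> f x = complex_of_real t * f x) \<longleftrightarrow>
    (\<forall>x. kernel_op \<Omega> (\<lambda>x y. complex_of_real (coeff_a l x y)) f x = complex_of_real t * f x)"
    if "supported \<Omega> f" for f
    unfolding dirichlet_poly_laplace_kernel[OF assms that]
    using that by (auto simp: supported_def kernel_op_def)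
  then show ?thesis
    by (auto simp: dirichlet_eigenspace_def functions_on_def simp flip: supported_def)
qed

lemma sorted_concat_replicate:
  assumes "sorted xs"
  shows "sorted (concat (map (\<lambda>t. replicate (m t) t) xs))"
  using assms by (induction xs) (auto simp: sorted_append)

lemma count_concat_replicate:
  assumes "distinct xs"
  shows "count (mset (concat (map (\<lambda>t. replicate (m t) t) xs))) t = (if t \<in> set xs then m t else 0)"
  using assms by (induction xs) auto

text \<open>An orthonormal eigenbasis determines the list: the \<open>\<phi> i\<close> with eigenvalue \<open>t\<close> are a
  basis of the eigenspace of \<open>t\<close>, because eigenfunctions for different eigenvalues are
  orthogonal. Both sides are then sorted lists in which \<open>t\<close> occurs equally often.\<close>

lemma dirichlet_eigenvalue_list_eq:
  fixes \<Omega> :: "(int ^ 'd::finite) set"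
  assumes fin: "finite \<Omega>" and on: "orthonormal_on \<Omega> (card \<Omega>) \<phi>"
    and ev: "\<And>i x. i < card \<Omega> \<Longrightarrow>
      kernel_op \<Omega> (\<lambda>x y. complex_of_real (coeff_a l x y)) (\<phi> i) x = complex_of_real (\<mu> i) * \<phi> i x"
  shows "dirichlet_eigenvalue_list l \<Omega> = sort (map \<mu> [0..<card \<Omega>])"
proof -
  let ?n = "card \<Omega>"
  let ?I = "\<lambda>t. {i. i < ?n \<and> \<mu> i = t}"
  let ?K = "\<lambda>x y. complex_of_real (coeff_a l x y)"
  have K: "?K y x = cnj (?K x y)" for x y
    by (simp add: coeff_a_commute)
  have phi: "\<phi> i \<in> dirichlet_eigenspace l \<Omega> (\<mu> i)" if "i < ?n" for i
    using that ev on by (auto simp: dirichlet_eigenspace_eq[OF fin] orthonormal_on_def)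
  have span: "f \<in> cfun.span (\<phi> ` ?I t)" if f: "f \<in> dirichlet_eigenspace l \<Omega> t" for f t
  proof -
    have supp: "supported \<Omega> f" and eig: "\<And>x. kernel_op \<Omega> ?K f x = complex_of_real t * f x"
      using f by (auto simp: dirichlet_eigenspace_eq[OF fin])
    have z: "inner_on \<Omega> f (\<phi> i) = 0" if i: "i < ?n" "\<mu> i \<noteq> t" for i
    proof -
      have "complex_of_real t * inner_on \<Omega> f (\<phi> i) = inner_on \<Omega> (kernel_op \<Omega> ?K f) (\<phi> i)"
        by (simp add: inner_on_def eig sum_distrib_left mult_ac)
      also have "\<dots> = inner_on \<Omega> f (kernel_op \<Omega> ?K (\<phi> i))"
        by (rule kernel_op_selfadjoint) (rule K)
      also have "\<dots> = complex_of_real (\<mu> i) * inner_on \<Omega> f (\<phi> i)"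
        by (simp add: inner_on_def ev[OF i(1)] sum_distrib_left mult_ac)
      finally show ?thesis using i(2) by simp
    qed
    have "f = (\<Sum>i\<in>?I t. (\<lambda>x. inner_on \<Omega> f (\<phi> i) * \<phi> i x))"
    proof
      fix x
      have "f x = (\<Sum>i<?n. inner_on \<Omega> f (\<phi> i) * \<phi> i x)"
        by (rule orthonormal_expansion[OF fin on supp])
      also have "\<dots> = (\<Sum>i\<in>?I t. inner_on \<Omega> f (\<phi> i) * \<phi> i x)"
        by (rule sum.mono_neutral_right) (auto simp: z)
      finally show "f x = (\<Sum>i\<in>?I t. (\<lambda>x. inner_on \<Omega> f (\<phi> i) * \<phi> i x)) x"
        by (simp add: sum_fun_apply)
    qed
    also have "\<dots> \<in> cfun.span (\<phi> ` ?I t)"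
      by (intro cfun.span_sum cfun.span_scale cfun.span_base) auto
    finally show ?thesis .
  qed
  have mult: "dirichlet_multiplicity l \<Omega> t = card (?I t)" for t
    unfolding dirichlet_multiplicity_def
  proof (rule cfun.dim_unique)
    show "\<phi> ` ?I t \<subseteq> dirichlet_eigenspace l \<Omega> t" using phi by auto
    show "dirichlet_eigenspace l \<Omega> t \<subseteq> cfun.span (\<phi> ` ?I t)" using span by blast
    show "cfun.independent (\<phi> ` ?I t)" by (rule orthonormal_independent[OF on]) auto
    show "card (\<phi> ` ?I t) = card (?I t)"
      by (intro card_image inj_on_subset[OF orthonormal_inj[OF on]]) auto
  qed
  have set: "dirichlet_eigenvalue_set l \<Omega> = \<mu> ` {..<?n}"
  proof (intro equalityI subsetI)
    fix t assume "t \<in> dirichlet_eigenvalue_set l \<Omega>"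
    then obtain f where f: "f \<in> dirichlet_eigenspace l \<Omega> t" "f \<noteq> 0"
      by (auto simp: dirichlet_eigenvalue_set_def)
    have "?I t \<noteq> {}"
    proof
      assume "?I t = {}"
      with span[OF f(1)] have "f \<in> cfun.span {}" by (simp only: image_empty)
      with f(2) show False by simp
    qed
    then show "t \<in> \<mu> ` {..<?n}" by auto
  next
    fix t assume "t \<in> \<mu> ` {..<?n}"
    then obtain i where i: "i < ?n" "t = \<mu> i" by auto
    have "inner_on \<Omega> (\<phi> i) (\<phi> i) = 1" using on i by (simp add: orthonormal_on_def)
    then have "\<phi> i \<noteq> 0" by (auto simp: inner_on_def)
    then show "t \<in> dirichlet_eigenvalue_set l \<Omega>"
      using phi[OF i(1)] i by (auto simp: dirichlet_eigenvalue_set_def)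
  qed
  have "mset (dirichlet_eigenvalue_list l \<Omega>) = mset (map \<mu> [0..<?n])"
  proof (rule multiset_eqI)
    fix t
    have "count (mset (dirichlet_eigenvalue_list l \<Omega>)) t = card (?I t)"
      unfolding dirichlet_eigenvalue_list_def
      by (subst count_concat_replicate) (auto simp: mult set)
    also have "\<dots> = count (image_mset \<mu> (mset_set {0..<?n})) t"
      by (subst count_image_mset') (auto intro!: arg_cong[of _ _ card])
    finally show "count (mset (dirichlet_eigenvalue_list l \<Omega>)) t = count (mset (map \<mu> [0..<?n])) t"
      by simp
  qed
  moreover have "sorted (dirichlet_eigenvalue_list l \<Omega>)"
    unfolding dirichlet_eigenvalue_list_def by (intro sorted_concat_replicate) simp
  ultimately show ?thesis
    by (intro properties_for_sort[symmetric]) auto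
qed

text \<open>Sorting the indices by their eigenvalue makes the \<open>i\<close>-th eigenfunction belong to
  the eigenvalue numbered \<open>Suc i\<close>.\<close>

lemma dirichlet_spectral:
  fixes \<Omega> :: "(int ^ 'd::finite) set"
  assumes fin: "finite \<Omega>"
  obtains \<phi> where "orthonormal_on \<Omega> (card \<Omega>) \<phi>"
    "\<And>i x. i < card \<Omega> \<Longrightarrow> kernel_op \<Omega> (\<lambda>x y. complex_of_real (coeff_a l x y)) (\<phi> i) x
       = complex_of_real (dirichlet_eigenvalue l \<Omega> (Suc i)) * \<phi> i x"
    "\<And>i j. i \<le> j \<Longrightarrow> j < card \<Omega> \<Longrightarrow> dirichlet_eigenvalue l \<Omega> (Suc i) \<le> dirichlet_eigenvalue l \<Omega> (Suc j)"
proof -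
  let ?n = "card \<Omega>"
  obtain \<phi> \<mu> where on: "orthonormal_on \<Omega> ?n \<phi>"
    and ev: "\<And>i x. i < ?n \<Longrightarrow> kernel_op \<Omega> (\<lambda>x y. complex_of_real (coeff_a l x y)) (\<phi> i) x
       = complex_of_real (\<mu> i) * \<phi> i x"
    using hermitian_kernel_spectral[OF fin, of "\<lambda>x y. complex_of_real (coeff_a l x y)"]
    by (metis coeff_a_commute complex_cnj_complex_of_real)
  let ?s = "sort_key \<mu> [0..<?n]"
  have list: "dirichlet_eigenvalue_list l \<Omega> = map \<mu> ?s"
  proof -
    have "sort (map \<mu> [0..<?n]) = map \<mu> ?s"
      by (rule properties_for_sort) auto
    then show ?thesis
      using dirichlet_eigenvalue_list_eq[OF fin on ev] by simp
  qed
  have nth: "dirichlet_eigenvalue l \<Omega> (Suc i) = \<mu> (?s ! i)" if "i < ?n" for i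
    using that by (simp add: dirichlet_eigenvalue_def list)
  have s: "?s ! i < ?n" if "i < ?n" for i
    using nth_mem[of i ?s] that by simp
  show ?thesis
  proof (rule that[of "\<lambda>i. \<phi> (?s ! i)"])
    show "orthonormal_on \<Omega> ?n (\<lambda>i. \<phi> (?s ! i))"
      using on s by (auto simp: orthonormal_on_def nth_eq_iff_index_eq)
    show "kernel_op \<Omega> (\<lambda>x y. complex_of_real (coeff_a l x y)) (\<phi> (?s ! i)) x
       = complex_of_real (dirichlet_eigenvalue l \<Omega> (Suc i)) * \<phi> (?s ! i) x" if "i < ?n" for i x
      using ev[OF s[OF that]] nth[OF that] by simp
    show "dirichlet_eigenvalue l \<Omega> (Suc i) \<le> dirichlet_eigenvalue l \<Omega> (Suc j)"
      if "i \<le> j" "j < ?n" for i j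
      using sorted_nth_mono[of "map \<mu> ?s" i j] that by (simp add: nth)
  qed
qed

section \<open>Plane waves and the Fourier transform on the lattice\<close>

text \<open>Lebesgue measure is the image of a product measure indexed by the basis vectors.\<close>

lemma lborel_integral_prod:
  fixes f :: "'b::euclidean_space \<Rightarrow> real \<Rightarrow> complex"
  assumes f: "\<And>b. b \<in> Basis \<Longrightarrow> integrable lborel (f b)"
  shows "(\<integral>z. (\<Prod>b\<in>Basis. f b (z \<bullet> b)) \<partial>lborel) = (\<Prod>b\<in>Basis. \<integral>t. f b t \<partial>lborel)"
proof -
  interpret product_sigma_finite "\<lambda>_ :: 'b. lborel :: real measure"
    by standard
  have [measurable]: "f b \<in> borel_measurable borel" if "b \<in> Basis" for b
    using borel_measurable_integrable[OF f[OF that]] by simp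
  have "(\<integral>z. (\<Prod>b\<in>Basis. f b (z \<bullet> b)) \<partial>lborel)
      = (\<integral>x. (\<Prod>b\<in>Basis. f b ((\<Sum>c\<in>Basis. x c *\<^sub>R c) \<bullet> b)) \<partial>(\<Pi>\<^sub>M b\<in>Basis. lborel))"
    by (subst lborel_eq, subst integral_distr) auto
  also have "\<dots> = (\<integral>x. (\<Prod>b\<in>Basis. f b (x b)) \<partial>(\<Pi>\<^sub>M b\<in>Basis. lborel))"
    by (intro Bochner_Integration.integral_cong refl prod.cong) simp
  also have "\<dots> = (\<Prod>b\<in>Basis. \<integral>t. f b t \<partial>lborel)"
    by (rule product_integral_prod) (auto simp: f)
  finally show ?thesis .
qed

lemma integral_cis_period:
  fixes k :: int
  shows "(\<integral>t. indicator {-pi..pi} t *\<^sub>R cis (of_int k * t) \<partial>lborel) = (if k = 0 then of_real (2 * pi) else 0)"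
proof (cases "k = 0")
  case True
  then show ?thesis by (simp add: scaleR_conv_of_real)
next
  case False
  define F where "F t = cis (of_int k * t) / (\<i> * of_int k)" for t :: real
  have "(F has_vector_derivative cis (of_int k * t)) (at t within {-pi..pi})" for t
    unfolding F_def cis_conv_exp
    by (rule has_vector_derivative_real_field | (auto intro!: derivative_eq_intros simp: False mult.commute[of _ \<i>]))+
  then have "(\<integral>t. indicator {-pi..pi} t *\<^sub>R cis (of_int k * t) \<partial>lborel) = F pi - F (-pi)"
    by (intro integral_FTC_atLeastAtMost) (auto intro!: continuous_intros)
  also have "cis (of_int k * pi) = cis (of_int k * - pi)"
    using sin_zero_iff_int2[of "of_int k * pi"] by (simp add: complex_eq_iff)
  then have "F pi - F (-pi) = 0"
    by (simp add: F_def)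
  finally show ?thesis using False by simp
qed

definition wave :: "real ^ 'd::finite \<Rightarrow> int ^ 'd \<Rightarrow> complex" where
  "wave z x = cis (\<Sum>i\<in>UNIV. of_int (x $ i) * z $ i)"

text \<open>One period of \<open>z \<mapsto> wave z x\<close> in every coordinate.\<close>

definition brillouin_zone :: "(real ^ 'd::finite) set" where
  "brillouin_zone = {z. \<forall>i. \<bar>z $ i\<bar> \<le> pi}"

definition freq_measure :: "(real ^ 'd::finite) measure" where
  "freq_measure = restrict_space lborel brillouin_zone"

lemma brillouin_zone_cbox: "brillouin_zone = cbox (\<chi> i. - pi) (\<chi> i. pi)"
  by (auto simp: set_eq_iff brillouin_zone_def mem_box_cart abs_le_iff minus_le_iff[of _ pi])

lemma compact_brillouin_zone: "compact brillouin_zone"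
  by (simp add: brillouin_zone_cbox)

lemma borel_brillouin_zone [measurable, simp]: "brillouin_zone \<in> sets borel"
  by (simp add: brillouin_zone_cbox)

lemma space_freq_measure [simp]: "space freq_measure = brillouin_zone"
  by (simp add: freq_measure_def space_restrict_space)

lemma integral_freq_measure:
  fixes f :: "real ^ 'd::finite \<Rightarrow> 'b::{banach, second_countable_topology}"
  shows "integral\<^sup>L freq_measure f = (\<integral>z. indicator brillouin_zone z *\<^sub>R f z \<partial>lborel)"
  unfolding freq_measure_def
  by (intro integral_restrict_space) simp

lemma integrable_freq_measure:
  fixes f :: "real ^ 'd::finite \<Rightarrow> 'b::{banach, second_countable_topology}"
  assumes "continuous_on UNIV f"
  shows "integrable freq_measure f"
proof -
  have "integrable lborel (\<lambda>z. indicator brillouin_zone z *\<^sub>R f z)"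
    using assms by (intro borel_integrable_compact compact_brillouin_zone continuous_on_subset[OF assms]) auto
  then show ?thesis
    unfolding freq_measure_def
    by (subst integrable_restrict_space) auto
qed

lemma integrable_freq_measure_cball:
  fixes f :: "real ^ 'd::finite \<Rightarrow> real"
  assumes "continuous_on UNIV f"
  shows "integrable freq_measure (\<lambda>z. indicator (cball 0 r) z * f z)"
proof -
  have "integrable lborel (\<lambda>z. indicator (brillouin_zone \<inter> cball 0 r) z *\<^sub>R f z)"
    by (intro borel_integrable_compact compact_Int compact_brillouin_zone compact_cball
        continuous_on_subset[OF assms]) auto
  then show ?thesis
    unfolding freq_measure_def
    by (subst integrable_restrict_space) (auto simp: indicator_inter_arith mult.assoc)
qed

lemma continuous_on_wave [continuous_intros]: "continuous_on A (\<lambda>z. wave z x)"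
  unfolding wave_def by (intro continuous_intros)

lemma wave_norm [simp]: "cmod (wave z x) = 1"
  by (simp add: wave_def)

lemma wave_add: "wave z (x + y) = wave z x * wave z y"
  by (simp add: wave_def cis_mult distrib_right sum.distrib)

lemma wave_minus: "wave z (- x) = cnj (wave z x)"
  by (simp add: wave_def cis_cnj sum_negf)

lemma wave_axis: "wave z (axis i s) = cis (of_int s * z $ i)"
proof -
  have "(\<Sum>j\<in>UNIV. of_int (axis i s $ j) * z $ j) = (\<Sum>j\<in>UNIV. if j = i then of_int s * z $ j else 0)"
    by (intro sum.cong) (auto simp: axis_def)
  then show ?thesis by (simp add: wave_def)
qed

text \<open>The integrand is a product of functions of one coordinate each. For \<open>x \<noteq> 0\<close> a coordinate
  with \<open>x $ i \<noteq> 0\<close> contributes the integral of a nontrivial character over a full period.\<close>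

lemma integral_wave:
  fixes x :: "int ^ 'd::finite"
  shows "(\<integral>z. wave z x \<partial>freq_measure) = (if x = 0 then (2 * pi) ^ CARD('d) else 0)"
proof -
  \<comment> \<open>the product formula is indexed by basis vectors, hence the detour from \<open>b\<close> back to its index\<close>
  define g where "g b t = indicator {-pi..pi} t *\<^sub>R cis (of_int (x $ (SOME i. b = axis i 1)) * t)"
    for b :: "real ^ 'd" and t
  have g: "g (axis i 1) = (\<lambda>t. indicator {-pi..pi} t *\<^sub>R cis (of_int (x $ i) * t))" for i
  proof -
    have "(SOME j. (axis i 1 :: real ^ 'd) = axis j 1) = i"
      by (intro some_equality) (auto simp: axis_eq_axis)
    then show ?thesis by (simp add: g_def fun_eq_iff)
  qed
  have inj: "inj (\<lambda>i :: 'd. axis i 1 :: real ^ 'd)"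
    by (auto simp: inj_def axis_eq_axis)
  have B: "(Basis :: (real ^ 'd) set) = range (\<lambda>i. axis i 1)"
    by (auto simp: Basis_vec_def)
  have int: "integrable lborel (g b)" for b
    unfolding g_def by (intro borel_integrable_compact continuous_intros) auto
  have "(\<integral>z. wave z x \<partial>freq_measure) = (\<integral>z. (\<Prod>b\<in>Basis. g b (z \<bullet> b)) \<partial>lborel)"
    unfolding integral_freq_measure
  proof (intro Bochner_Integration.integral_cong refl)
    fix z :: "real ^ 'd"
    have "(\<Prod>b\<in>Basis. g b (z \<bullet> b)) = (\<Prod>i\<in>UNIV. g (axis i 1) (z $ i))"
      unfolding B by (subst prod.reindex[OF inj]) (simp add: inner_axis)
    also have "\<dots> = (\<Prod>i\<in>UNIV. of_real (indicator {-pi..pi} (z $ i))) * (\<Prod>i\<in>UNIV. cis (of_int (x $ i) * z $ i))"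
      by (simp add: g scaleR_conv_of_real prod.distrib)
    also have "(\<Prod>i\<in>UNIV. cis (of_int (x $ i) * z $ i)) = wave z x"
      unfolding wave_def cis_conv_exp by (simp add: sum_distrib_left exp_sum)
    also have "(\<Prod>i\<in>UNIV. complex_of_real (indicator {-pi..pi} (z $ i))) = of_real (indicator brillouin_zone z)"
    proof (cases "z \<in> brillouin_zone")
      case True
      then show ?thesis by (auto simp: brillouin_zone_def indicator_def abs_le_iff minus_le_iff[of _ pi] intro!: prod.neutral)
    next
      case False
      then obtain i where "\<bar>z $ i\<bar> > pi" by (auto simp: brillouin_zone_def not_le)
      then have "indicator {-pi..pi} (z $ i) = (0 :: real)" by (auto simp: indicator_def abs_if split: if_splits)
      then show ?thesis using False by (auto intro!: bexI[of _ i])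
    qed
    finally show "indicator brillouin_zone z *\<^sub>R wave z x = (\<Prod>b\<in>Basis. g b (z \<bullet> b))"
      by (simp add: scaleR_conv_of_real)
  qed
  also have "\<dots> = (\<Prod>b\<in>Basis. \<integral>t. g b t \<partial>lborel)"
    by (rule lborel_integral_prod) (rule int)
  also have "\<dots> = (\<Prod>i\<in>UNIV. if x $ i = 0 then of_real (2 * pi) else 0)"
    unfolding B by (subst prod.reindex[OF inj]) (simp only: g integral_cis_period comp_def)
  also have "\<dots> = (if x = 0 then (2 * pi) ^ CARD('d) else 0)"
  proof (cases "x = 0")
    case False
    then obtain i where "x $ i \<noteq> 0" by (auto simp: vec_eq_iff)
    with False show ?thesis by (auto intro!: bexI[of _ i])
  qed simp
  finally show ?thesis .
qed

lemma integral_wave_cnj_wave: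
  fixes x y :: "int ^ 'd::finite"
  shows "(\<integral>z. wave z x * cnj (wave z y) \<partial>freq_measure) = (if x = y then (2 * pi) ^ CARD('d) else 0)"
  using integral_wave[of "x - y"] wave_add[of _ x "- y"] by (simp add: wave_minus)

text \<open>The eigenvalue of \<open>- \<Delta>\<close> at the plane wave of frequency \<open>z\<close>.\<close>

definition symbol :: "real ^ 'd::finite \<Rightarrow> real" where
  "symbol z = (\<Sum>i\<in>UNIV. 2 - 2 * cos (z $ i))"

lemma continuous_on_symbol [continuous_intros]: "continuous_on A symbol"
  unfolding symbol_def[abs_def] by (intro continuous_intros)

lemma symbol_nonneg: "symbol z \<ge> 0"
  unfolding symbol_def by (intro sum_nonneg) simp

lemma neighbour_sum_wave:
  fixes z :: "real ^ 'd::finite"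
  shows "neighbour_sum (wave z) x = of_real (\<Sum>i\<in>UNIV. 2 * cos (z $ i)) * wave z x"
proof -
  have inj: "inj_on (\<lambda>(i :: 'd, s :: int). x - axis i s) (UNIV \<times> {1, -1})"
    by (auto simp: inj_on_def axis_eq_axis)
  have m: "wave z (x - y) = wave z x * cnj (wave z y)" for y
    using wave_add[of z x "- y"] by (simp add: wave_minus)
  have "neighbour_sum (wave z) x = (\<Sum>i\<in>UNIV. \<Sum>s\<in>{1,-1}. wave z (x - axis i s))"
    unfolding neighbour_sum_def neighbours_eq
    by (subst sum.reindex[OF inj]) (simp only: sum.cartesian_product case_prod_unfold o_def)
  also have "\<dots> = (\<Sum>i\<in>UNIV. of_real (2 * cos (z $ i)) * wave z x)"
    by (intro sum.cong refl) (simp add: m wave_axis complex_eq_iff)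
  finally show ?thesis by (simp add: sum_distrib_right)
qed

lemma laplacian_power_wave:
  fixes z :: "real ^ 'd::finite"
  shows "(-1) ^ l * (laplacian ^^ l) (wave z) x = of_real (symbol z ^ l) * wave z x"
proof -
  have 1: "laplacian (\<lambda>x. c * wave z x) = (\<lambda>x. - of_real (symbol z) * c * wave z x)" for c
  proof
    fix x
    have "laplacian (\<lambda>x. c * wave z x) x = c * (neighbour_sum (wave z) x - of_nat (2 * CARD('d)) * wave z x)"
      by (simp add: laplacian_eq neighbour_sum_def right_diff_distrib mult_ac sum_distrib_left)
    then show "laplacian (\<lambda>x. c * wave z x) x = - of_real (symbol z) * c * wave z x"
      by (simp add: neighbour_sum_wave symbol_def sum_subtractf algebra_simps)
  qed
  have "(laplacian ^^ l) (wave z) = (\<lambda>x. (- of_real (symbol z)) ^ l * wave z x)"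
  proof (induction l)
    case (Suc l)
    then show ?case by (simp add: 1)
  qed simp
  then show ?thesis
    by (simp flip: mult.assoc power_mult_distrib)
qed

lemma coeff_a_wave:
  assumes "finite Y" "reach l x \<subseteq> Y"
  shows "(\<Sum>y\<in>Y. complex_of_real (coeff_a l x y) * wave z y) = of_real (symbol z ^ l) * wave z x"
  unfolding laplacian_power_wave[symmetric] using assms
  by (intro laplacian_power_kernel[symmetric]) auto

definition lattice_fourier :: "(int ^ 'd::finite) set \<Rightarrow> (int ^ 'd \<Rightarrow> complex) \<Rightarrow> real ^ 'd \<Rightarrow> complex" where
  "lattice_fourier \<Omega> f z = inner_on \<Omega> f (wave z)"

lemma continuous_on_lattice_fourier [continuous_intros]: "continuous_on A (lattice_fourier \<Omega> f)"
  unfolding lattice_fourier_def[abs_def] inner_on_def by (intro continuous_intros)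

text \<open>\<open>symbol z ^ l\<close> is absorbed into one of the two factors of \<open>|lattice_fourier \<Omega> f z|\<^sup>2\<close> by
  \<open>coeff_a_wave\<close>; what remains is a finite sum of products of two waves, and orthogonality of the
  waves picks out the terms of the quadratic form. The case \<open>l = 0\<close> is Plancherel's identity.\<close>

lemma plancherel_symbol:
  fixes \<Omega> :: "(int ^ 'd::finite) set"
  assumes "finite \<Omega>"
  shows "(\<integral>z. complex_of_real (symbol z ^ l * (cmod (lattice_fourier \<Omega> f z))\<^sup>2) \<partial>freq_measure)
    = (2 * pi) ^ CARD('d) * inner_on \<Omega> (kernel_op \<Omega> (\<lambda>x y. complex_of_real (coeff_a l x y)) f) f"
proof -
  \<comment> \<open>one finite index set for all rows of the kernel\<close>
  define Y where "Y = \<Omega> \<union> (\<Union>x\<in>\<Omega>. reach l x)"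
  have Y: "finite Y" "\<Omega> \<subseteq> Y" "\<And>x. x \<in> \<Omega> \<Longrightarrow> reach l x \<subseteq> Y"
    using assms by (auto simp: Y_def finite_reach)
  let ?a = "\<lambda>x y. complex_of_real (coeff_a l x y)"
  have "complex_of_real (symbol z ^ l * (cmod (lattice_fourier \<Omega> f z))\<^sup>2)
     = (\<Sum>x\<in>\<Omega>. \<Sum>y\<in>Y. \<Sum>w\<in>\<Omega>. cnj (f x) * ?a x y * f w * (wave z y * cnj (wave z w)))" for z
  proof -
    have "complex_of_real (symbol z ^ l * (cmod (lattice_fourier \<Omega> f z))\<^sup>2)
       = (of_real (symbol z ^ l) * cnj (inner_on \<Omega> f (wave z))) * inner_on \<Omega> f (wave z)"
      by (simp only: lattice_fourier_def of_real_mult complex_norm_square mult_ac)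
    also have "of_real (symbol z ^ l) * cnj (inner_on \<Omega> f (wave z))
       = (\<Sum>x\<in>\<Omega>. cnj (f x) * (of_real (symbol z ^ l) * wave z x))"
      by (simp add: inner_on_def sum_distrib_left mult_ac)
    also have "\<dots> = (\<Sum>x\<in>\<Omega>. cnj (f x) * (\<Sum>y\<in>Y. ?a x y * wave z y))"
      by (intro sum.cong refl) (simp add: coeff_a_wave Y)
    also have "\<dots> * inner_on \<Omega> f (wave z)
       = (\<Sum>x\<in>\<Omega>. \<Sum>y\<in>Y. \<Sum>w\<in>\<Omega>. cnj (f x) * ?a x y * f w * (wave z y * cnj (wave z w)))"
      unfolding inner_on_def by (simp add: sum_distrib_left sum_distrib_right mult_ac)
    finally show ?thesis .
  qed
  then have "(\<integral>z. complex_of_real (symbol z ^ l * (cmod (lattice_fourier \<Omega> f z))\<^sup>2) \<partial>freq_measure)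
     = (\<integral>z. (\<Sum>x\<in>\<Omega>. \<Sum>y\<in>Y. \<Sum>w\<in>\<Omega>. cnj (f x) * ?a x y * f w * (wave z y * cnj (wave z w))) \<partial>freq_measure)"
    by simp
  also have "\<dots> = (\<Sum>x\<in>\<Omega>. \<Sum>y\<in>Y. \<Sum>w\<in>\<Omega>. cnj (f x) * ?a x y * f w *
       (\<integral>z. wave z y * cnj (wave z w) \<partial>freq_measure))"
    by (subst Bochner_Integration.integral_sum Bochner_Integration.integral_mult_right_zero |
        (intro integrable_freq_measure continuous_intros; fail) | (intro sum.cong refl))+
  also have "\<dots> = (\<Sum>x\<in>\<Omega>. \<Sum>y\<in>Y. if y \<in> \<Omega> then cnj (f x) * ?a x y * f y * (2 * pi) ^ CARD('d) else 0)"
    unfolding integral_wave_cnj_wave using assms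
    by (intro sum.cong refl) (simp add: if_distrib[of complex_of_real] if_distrib[of "\<lambda>z. _ * z"] cong: if_cong)
  also have "\<dots> = (\<Sum>x\<in>\<Omega>. \<Sum>y\<in>\<Omega>. cnj (f x) * ?a x y * f y * (2 * pi) ^ CARD('d))"
    by (rule sum.cong[OF refl]) (simp only: sum.inter_restrict[OF Y(1), symmetric] Int_absorb1[OF Y(2)])
  also have "\<dots> = (2 * pi) ^ CARD('d) * inner_on \<Omega> (kernel_op \<Omega> ?a f) f"
    by (simp add: inner_on_def kernel_op_def sum_distrib_left sum_distrib_right mult_ac)
  finally show ?thesis .
qed

section \<open>Moments of Euclidean balls\<close>

text \<open>Write \<open>r ^ q - |z| ^ q\<close> as the integral of \<open>q t ^ (q - 1)\<close> over \<open>|z| \<le> t \<le> r\<close> and exchange the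
  integrals: the inner one becomes the volume of the ball of radius \<open>t\<close>. Starting from the
  difference rather than from \<open>|z| ^ q\<close> yields balls instead of shells.\<close>

lemma ball_moment:
  fixes q :: nat
  assumes r: "r \<ge> 0"
  shows "(\<integral>z. indicator (cball 0 r) z * norm z ^ q \<partial>(lborel :: 'a::euclidean_space measure))
     = real DIM('a) / real (DIM('a) + q) * unit_ball_vol (real DIM('a)) * r ^ (DIM('a) + q)"
proof -
  let ?n = "DIM('a)" and ?V = "unit_ball_vol (real DIM('a))"
  have V: "?V \<ge> 0" by simp
  have mom: "(\<integral>z. indicator (cball 0 r) z * (r ^ q - norm z ^ q) \<partial>(lborel :: 'a measure))
      = real q / real (?n + q) * ?V * r ^ (?n + q)"
  proof (cases "q = 0")
    case False
    then obtain p where p: "q = Suc p" by (cases q) auto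
    have eq: "ennreal (indicator (cball 0 r) z * (r ^ q - norm z ^ q))
       = (\<integral>\<^sup>+t. ennreal (real q * t ^ p) * indicator {0..r} t * indicator (cball 0 t) z \<partial>lborel)" for z :: 'a
    proof (cases "norm z \<le> r")
      case True
      have "ennreal (r ^ q - norm z ^ q) = (\<integral>\<^sup>+t. ennreal (real q * t ^ p) * indicator {norm z..r} t \<partial>lborel)"
      proof (intro nn_integral_FTC_Icc[where F = "\<lambda>t. t ^ q", symmetric])
        fix t assume "t \<in> {norm z..r}"
        then have "t \<ge> 0" using norm_ge_zero[of z] by (simp del: norm_ge_zero)
        then show "0 \<le> real q * t ^ p" by simp
        show "((\<lambda>t. t ^ q) has_real_derivative real q * t ^ p) (at t)"
          using DERIV_pow[of q t] by (simp add: p)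
      qed (use True in auto)
      also have "\<dots> = (\<integral>\<^sup>+t. ennreal (real q * t ^ p) * indicator {0..r} t * indicator (cball 0 t) z \<partial>lborel)"
        by (intro nn_integral_cong) (auto simp: indicator_def order_trans[OF norm_ge_zero, of z])
      finally show ?thesis using True by simp
    next
      case False
      then have zero: "ennreal (real q * t ^ p) * indicator {0..r} t * indicator (cball 0 t) z = 0" for t
        by (auto simp: indicator_def)
      show ?thesis unfolding zero using False by simp
    qed
    have [measurable]: "(\<lambda>(t, z). indicator (cball 0 t) z :: ennreal) \<in> borel_measurable (lborel \<Otimes>\<^sub>M (lborel :: 'a measure))"
    proof -
      have "(\<lambda>(t, z). indicator (cball 0 t) z :: ennreal) = (\<lambda>x :: real \<times> 'a. indicator {x. norm (snd x) \<le> fst x} x)"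
        by (auto simp: indicator_def fun_eq_iff)
      then show ?thesis by simp
    qed
    have "(\<integral>\<^sup>+z. ennreal (indicator (cball 0 r) z * (r ^ q - norm z ^ q)) \<partial>(lborel :: 'a measure))
      = (\<integral>\<^sup>+z. \<integral>\<^sup>+t. ennreal (real q * t ^ p) * indicator {0..r} t * indicator (cball 0 t) z \<partial>lborel \<partial>(lborel :: 'a measure))"
      by (simp only: eq)
    also have "\<dots> = (\<integral>\<^sup>+t. \<integral>\<^sup>+z. ennreal (real q * t ^ p) * indicator {0..r} t * indicator (cball 0 t) z \<partial>(lborel :: 'a measure) \<partial>lborel)"
      by (rule lborel_pair.Fubini') measurable
    also have "\<dots> = (\<integral>\<^sup>+t. ennreal (real q * ?V * t ^ (?n + p)) * indicator {0..r} t \<partial>lborel)"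
    proof (intro nn_integral_cong)
      fix t :: real
      have "(\<integral>\<^sup>+z. ennreal (real q * t ^ p) * indicator {0..r} t * indicator (cball 0 t) z \<partial>(lborel :: 'a measure))
         = ennreal (real q * t ^ p) * indicator {0..r} t * emeasure lborel (cball 0 t :: 'a set)"
        by (subst nn_integral_cmult) auto
      also have "\<dots> = ennreal (real q * ?V * t ^ (?n + p)) * indicator {0..r} t"
        by (auto simp: indicator_def emeasure_cball power_add mult_ac simp flip: ennreal_mult)
      finally show "(\<integral>\<^sup>+z. ennreal (real q * t ^ p) * indicator {0..r} t * indicator (cball 0 t) z \<partial>(lborel :: 'a measure))
         = ennreal (real q * ?V * t ^ (?n + p)) * indicator {0..r} t" .
    qed
    also have "\<dots> = ennreal (real q / real (?n + q) * ?V * r ^ (?n + q) - real q / real (?n + q) * ?V * 0 ^ (?n + q))"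
    proof (intro nn_integral_FTC_Icc[where F = "\<lambda>t. real q / real (?n + q) * ?V * t ^ (?n + q)"])
      fix t :: real
      show "((\<lambda>t. real q / real (?n + q) * ?V * t ^ (?n + q)) has_real_derivative real q * ?V * t ^ (?n + p)) (at t)"
        by (rule DERIV_cong[OF DERIV_cmult[OF DERIV_pow]]) (simp add: p)
    qed (use r V in auto)
    also have "\<dots> = ennreal (real q / real (?n + q) * ?V * r ^ (?n + q))"
      by (simp add: p)
    finally have *: "(\<integral>\<^sup>+z. ennreal (indicator (cball 0 r) z * (r ^ q - norm z ^ q)) \<partial>(lborel :: 'a measure)) = \<dots>" .
    have "has_bochner_integral (lborel :: 'a measure) (\<lambda>z. indicator (cball 0 r) z * (r ^ q - norm z ^ q))
        (real q / real (?n + q) * ?V * r ^ (?n + q))"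
      using r V by (intro has_bochner_integral_nn_integral *) (auto simp: indicator_def power_mono)
    then show ?thesis by (rule has_bochner_integral_integral_eq)
  qed simp
  have int: "integrable lborel (\<lambda>z :: 'a. indicator (cball 0 r) z * f z)" if "continuous_on UNIV f" for f :: "'a \<Rightarrow> real"
    using borel_integrable_compact[of "cball 0 r :: 'a set" f] continuous_on_subset[OF that] by auto
  have "(\<integral>z. indicator (cball 0 r) z * r ^ q \<partial>(lborel :: 'a measure)) = r ^ q * (?V * r ^ ?n)"
    using r content_cball[of r "0 :: 'a"] by (simp add: mult.commute)
  also have "(\<integral>z. indicator (cball 0 r) z * r ^ q \<partial>(lborel :: 'a measure))
     = (\<integral>z. indicator (cball 0 r) z * norm z ^ q + indicator (cball 0 r) z * (r ^ q - norm z ^ q) \<partial>(lborel :: 'a measure))"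
    by (simp add: algebra_simps)
  also have "\<dots> = (\<integral>z. indicator (cball 0 r) z * norm z ^ q \<partial>(lborel :: 'a measure)) + real q / real (?n + q) * ?V * r ^ (?n + q)"
    unfolding mom[symmetric] by (intro Bochner_Integration.integral_add int continuous_intros)
  finally have "(\<integral>z. indicator (cball 0 r) z * norm z ^ q \<partial>(lborel :: 'a measure))
      = (1 - real q / real (?n + q)) * (?V * r ^ (?n + q))"
    by (simp add: algebra_simps power_add)
  also have "1 - real q / real (?n + q) = real ?n / real (?n + q)"
  proof -
    have "real ?n + real q > 0" using DIM_positive[where 'a = 'a] by (intro add_pos_nonneg) auto
    then show ?thesis by (simp add: divide_simps)
  qed
  finally show ?thesis by simp
qed

lemma cball_subset_brillouin_zone: "r \<le> pi \<Longrightarrow> cball 0 r \<subseteq> brillouin_zone"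
  using component_le_norm_cart by (fastforce simp: brillouin_zone_def intro: order_trans)

lemma freq_measure_ball_moment:
  assumes "0 \<le> r" "r \<le> pi"
  shows "(\<integral>z. indicator (cball 0 r) z * norm z ^ q \<partial>(freq_measure :: (real ^ 'd::finite) measure))
     = real CARD('d) / real (CARD('d) + q) * unit_ball_vol (real CARD('d)) * r ^ (CARD('d) + q)"
proof -
  have "(\<integral>z. indicator (cball 0 r) z * norm z ^ q \<partial>(freq_measure :: (real ^ 'd) measure))
     = (\<integral>z. indicator (cball 0 r) z * norm z ^ q \<partial>(lborel :: (real ^ 'd) measure))"
    unfolding integral_freq_measure
    by (rule Bochner_Integration.integral_cong[OF refl])
       (use cball_subset_brillouin_zone[OF assms(2)] in \<open>auto simp: indicator_def\<close>)
  then show ?thesis using ball_moment[OF assms(1), of q, where 'a = "real ^ 'd"] by simp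
qed

section \<open>Bounds for the symbol\<close>

lemma norm_sq_vec: "(norm z)\<^sup>2 = (\<Sum>i\<in>UNIV. (z $ i)\<^sup>2)" for z :: "real ^ 'd::finite"
  unfolding power2_norm_eq_inner inner_vec_def by (simp add: power2_eq_square)

text \<open>In each coordinate \<open>2 - 2 cos t = 4 sin\<^sup>2 (t/2) \<le> t\<^sup>2\<close>.\<close>

lemma symbol_le: "symbol z \<le> (norm z)\<^sup>2"
  unfolding symbol_def norm_sq_vec
proof (intro sum_mono)
  fix i
  have "2 - 2 * cos (z $ i) = 4 * (sin (z $ i / 2))\<^sup>2"
    using cos_double_sin[of "z $ i / 2"] by simp
  also have "\<dots> \<le> 4 * (z $ i / 2)\<^sup>2"
    using abs_sin_x_le_abs_x[of "z $ i / 2"]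
    by (intro mult_left_mono) (simp_all only: abs_le_square_iff zero_le_numeral)
  finally show "2 - 2 * cos (z $ i) \<le> (z $ i)\<^sup>2" by (simp add: power_divide)
qed

lemma cos_le_quartic: "cos t \<le> 1 - t\<^sup>2 / 2 + t ^ 4 / 24" for t :: real
proof -
  obtain u where "cos t = (\<Sum>m<4. cos_coeff m * t ^ m) + cos (u + 1 / 2 * real 4 * pi) / fact 4 * t ^ 4"
    using Maclaurin_cos_expansion[of t 4] by blast
  moreover have "{..<4} = {0, 1, 2, 3 :: nat}" by auto
  then have "(\<Sum>m<4. cos_coeff m * t ^ m) = 1 - t\<^sup>2 / 2"
    by (simp add: cos_coeff_def)
  moreover have "cos (u + 1 / 2 * real 4 * pi) / fact 4 * t ^ 4 \<le> 1 / 24 * t ^ 4"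
    by (intro mult_right_mono) (auto simp: fact_numeral)
  ultimately show ?thesis by linarith
qed

text \<open>This is \<open>s - s\<^sup>2/12\<close> up to its maximum at \<open>s = 6\<close>, continued by the constant \<open>3\<close>. In this
  form monotonicity and continuity can be read off.\<close>

definition minorant :: "real \<Rightarrow> real" where
  "minorant s = 3 - (max 0 (6 - s))\<^sup>2 / 12"

lemma minorant_eq: "s \<le> 6 \<Longrightarrow> minorant s = s - s\<^sup>2 / 12"
  by (simp add: minorant_def power2_eq_square algebra_simps) (simp add: field_simps)

lemma minorant_mono: "s \<le> t \<Longrightarrow> minorant s \<le> minorant t"
  unfolding minorant_def by (intro diff_mono divide_right_mono power_mono) auto

lemma minorant_0 [simp]: "minorant 0 = 0"
  by (simp add: minorant_def)

lemma minorant_nonneg: "0 \<le> s \<Longrightarrow> 0 \<le> minorant s"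
  using minorant_mono[of 0 s] by simp

lemma continuous_on_minorant [continuous_intros]:
  "continuous_on A f \<Longrightarrow> continuous_on A (\<lambda>z. minorant (f z))"
  unfolding minorant_def by (intro continuous_intros) auto

text \<open>A concave function on \<open>[0, \<infinity>)\<close> that vanishes at \<open>0\<close> is subadditive; here this is checked
  case by case on the two branches.\<close>

lemma minorant_subadditive:
  assumes "0 \<le> a" "0 \<le> b"
  shows "minorant (a + b) \<le> minorant a + minorant b"
proof -
  have le3: "minorant s \<le> 3" for s by (simp add: minorant_def)
  have eq3: "minorant s = 3" if "s \<ge> 6" for s using that by (simp add: minorant_def)
  consider "a \<ge> 6" | "b \<ge> 6" | "a + b \<le> 6" | "a \<le> 6" "b \<le> 6" "a + b \<ge> 6" by linarith
  then show ?thesis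
  proof cases
    case 1
    then show ?thesis using le3[of "a + b"] eq3[of a] minorant_nonneg[of b] assms by linarith
  next
    case 2
    then show ?thesis using le3[of "a + b"] eq3[of b] minorant_nonneg[of a] assms by linarith
  next
    case 3
    have "0 \<le> a * b" using assms by simp
    with 3 assms show ?thesis by (simp add: minorant_eq power2_sum add_divide_distrib)
  next
    case 4
    \<comment> \<open>\<open>b\<close> is at least \<open>6 - a\<close>, and \<open>minorant a + minorant (6 - a) - 3 = a (6 - a) / 6\<close>\<close>
    have "0 \<le> a * (6 - a)" using assms 4 by simp
    then have "3 \<le> minorant a + minorant (6 - a)"
      using assms 4 by (simp add: minorant_eq power2_eq_square algebra_simps add_divide_distrib diff_divide_distrib)
    also have "minorant (6 - a) \<le> minorant b" using 4 by (intro minorant_mono) linarith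
    finally show ?thesis using le3[of "a + b"] by linarith
  qed
qed

lemma minorant_sum:
  assumes "\<And>i. i \<in> I \<Longrightarrow> 0 \<le> s i"
  shows "minorant (\<Sum>i\<in>I. s i) \<le> (\<Sum>i\<in>I. minorant (s i))"
  using assms
proof (induction I rule: infinite_finite_induct)
  case (insert i I)
  then have "minorant (s i + (\<Sum>i\<in>I. s i)) \<le> minorant (s i) + minorant (\<Sum>i\<in>I. s i)"
    by (intro minorant_subadditive sum_nonneg) auto
  with insert show ?case by fastforce
qed auto

text \<open>For \<open>t\<^sup>2 \<le> 6\<close> this is the quartic Taylor bound. For larger \<open>|t|\<close> the right-hand side is
  still increasing up to \<open>|t| = \<pi>\<close>, and it is at least \<open>3\<close> already at \<open>|t| = \<surd>6\<close>, by the same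
  Taylor bound.\<close>

lemma minorant_le_cos:
  assumes "\<bar>t\<bar> \<le> pi"
  shows "minorant (t\<^sup>2) \<le> 2 - 2 * cos t"
proof (cases "t\<^sup>2 \<le> 6")
  case True
  then show ?thesis
    using cos_le_quartic[of t] by (simp add: minorant_eq flip: power_mult)
next
  case False
  have "sqrt 6 \<le> \<bar>t\<bar>"
    using False by (intro real_le_lsqrt) (auto simp: real_sqrt_le_iff)
  then have "cos \<bar>t\<bar> \<le> cos (sqrt 6)"
    using assms by (intro cos_monotone_0_pi_le) auto
  also have "cos (sqrt 6) \<le> - 1 / 2"
  proof -
    have "sqrt 6 ^ (2 * 2) = (sqrt 6 ^ 2) ^ 2" by (rule power_mult)
    then have "sqrt 6 ^ 4 = 36" by simp
    then show ?thesis using cos_le_quartic[of "sqrt 6"] by simp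
  qed
  finally have "3 \<le> 2 - 2 * cos t" by simp
  moreover have "minorant (t\<^sup>2) \<le> 3" by (simp add: minorant_def)
  ultimately show ?thesis by simp
qed

lemma minorant_le_symbol:
  assumes "z \<in> brillouin_zone"
  shows "minorant ((norm z)\<^sup>2) \<le> symbol z"
proof -
  have "minorant ((norm z)\<^sup>2) \<le> (\<Sum>i\<in>UNIV. minorant ((z $ i)\<^sup>2))"
    unfolding norm_sq_vec by (intro minorant_sum) simp
  also have "\<dots> \<le> symbol z"
    unfolding symbol_def using assms by (intro sum_mono minorant_le_cos) (auto simp: brillouin_zone_def)
  finally show ?thesis .
qed

lemma sqrt6_le_pi: "sqrt 6 \<le> pi"
proof -
  have "(6 :: real) \<le> 3\<^sup>2" by simp
  then have "sqrt 6 \<le> 3" by (intro real_le_lsqrt) auto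
  then show ?thesis using pi_gt3 by simp
qed

section \<open>Eigenvalue estimates\<close>

text \<open>Compare \<open>w\<close> with the weight \<open>e\<close> that is \<open>c\<close> on the first \<open>k\<close> indices and \<open>0\<close> after them. Both
  have the same total, and \<open>\<mu> i - \<mu> (k - 1)\<close> and \<open>w i - e i\<close> never have opposite signs.\<close>

lemma weighted_sum_ge_initial_sum:
  fixes \<mu> w :: "nat \<Rightarrow> real"
  assumes mono: "\<And>i j. i \<le> j \<Longrightarrow> j < n \<Longrightarrow> \<mu> i \<le> \<mu> j"
    and w: "\<And>i. i < n \<Longrightarrow> 0 \<le> w i" "\<And>i. i < n \<Longrightarrow> w i \<le> c"
    and sum: "(\<Sum>i<n. w i) = c * real k" and k: "1 \<le> k" "k \<le> n"
  shows "c * (\<Sum>i<k. \<mu> i) \<le> (\<Sum>i<n. \<mu> i * w i)"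
proof -
  let ?m = "\<mu> (k - 1)" and ?e = "\<lambda>i. if i < k then c else 0"
  have sub: "{..<n} \<inter> {i. i < k} = {..<k}" using k by auto
  have "0 \<le> (\<Sum>i<n. (\<mu> i - ?m) * (w i - ?e i))"
  proof (intro sum_nonneg)
    fix i assume "i \<in> {..<n}"
    then show "0 \<le> (\<mu> i - ?m) * (w i - ?e i)"
      using mono[of i "k - 1"] mono[of "k - 1" i] w[of i] k
      by (cases "i < k") (auto intro: mult_nonpos_nonpos)
  qed
  also have "\<dots> = (\<Sum>i<n. \<mu> i * w i) - (\<Sum>i<n. if i < k then \<mu> i * c else 0)
      - ?m * ((\<Sum>i<n. w i) - (\<Sum>i<n. ?e i))"
    unfolding sum_distrib_left sum_subtractf[symmetric]
    by (intro sum.cong refl) (simp add: algebra_simps)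
  also have "(\<Sum>i<n. ?e i) = c * real k"
    using sub by (simp add: sum.If_cases)
  also have "(\<Sum>i<n. if i < k then \<mu> i * c else 0) = c * (\<Sum>i<k. \<mu> i)"
    using sub by (simp add: sum.If_cases sum_distrib_left mult.commute)
  finally show ?thesis using sum by simp
qed

text \<open>For \<open>x \<in> \<Omega>\<close> the full row of the kernel sends \<open>wave z\<close> to \<open>symbol z ^ l * wave z x\<close>. The
  row truncated to \<open>\<Omega>\<close> misses the entries with \<open>y \<notin> \<Omega>\<close>, whose absolute values, over all
  rows together, add up to at most \<open>boundary_size l \<Omega>\<close>.\<close>

lemma wave_energy_le:
  fixes \<Omega> :: "(int ^ 'd::finite) set"
  assumes "finite \<Omega>"
  shows "Re (inner_on \<Omega> (kernel_op \<Omega> (\<lambda>x y. complex_of_real (coeff_a l x y)) (wave z)) (wave z))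
    \<le> real (card \<Omega>) * symbol z ^ l + boundary_size l \<Omega>"
proof -
  define Y where "Y = (\<Union>x\<in>\<Omega>. reach l x) - \<Omega>"
  have Y: "finite Y" "Y \<inter> \<Omega> = {}" "\<And>x. x \<in> \<Omega> \<Longrightarrow> reach l x \<subseteq> \<Omega> \<union> Y"
    using assms by (auto simp: Y_def finite_reach)
  let ?a = "\<lambda>x y. complex_of_real (coeff_a l x y)"
  define E where "E = (\<Sum>x\<in>\<Omega>. \<Sum>y\<in>Y. ?a x y * wave z y * cnj (wave z x))"
  have "inner_on \<Omega> (kernel_op \<Omega> ?a (wave z)) (wave z)
      = (\<Sum>x\<in>\<Omega>. (\<Sum>y\<in>\<Omega>. ?a x y * wave z y) * cnj (wave z x))"
    by (simp add: inner_on_def kernel_op_def)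
  also have "\<dots> = (\<Sum>x\<in>\<Omega>. of_real (symbol z ^ l) - (\<Sum>y\<in>Y. ?a x y * wave z y * cnj (wave z x)))"
  proof (intro sum.cong refl)
    fix x assume x: "x \<in> \<Omega>"
    have "(\<Sum>y\<in>\<Omega>. ?a x y * wave z y) + (\<Sum>y\<in>Y. ?a x y * wave z y) = of_real (symbol z ^ l) * wave z x"
      using coeff_a_wave[of "\<Omega> \<union> Y" l x z] assms Y x by (simp add: sum.union_disjoint Int_commute)
    then have split: "(\<Sum>y\<in>\<Omega>. ?a x y * wave z y) = of_real (symbol z ^ l) * wave z x - (\<Sum>y\<in>Y. ?a x y * wave z y)"
      by (simp only: eq_diff_eq)
    have "(\<Sum>y\<in>\<Omega>. ?a x y * wave z y) * cnj (wave z x)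
        = of_real (symbol z ^ l) * (wave z x * cnj (wave z x)) - (\<Sum>y\<in>Y. ?a x y * wave z y) * cnj (wave z x)"
      unfolding split by (simp only: left_diff_distrib mult.assoc)
    also have "wave z x * cnj (wave z x) = 1"
      by (simp flip: complex_norm_square)
    finally show "(\<Sum>y\<in>\<Omega>. ?a x y * wave z y) * cnj (wave z x)
        = of_real (symbol z ^ l) - (\<Sum>y\<in>Y. ?a x y * wave z y * cnj (wave z x))"
      by (simp add: sum_distrib_right)
  qed
  also have "\<dots> = of_real (real (card \<Omega>) * symbol z ^ l) - E"
    by (simp add: sum_subtractf E_def)
  finally have eq: "inner_on \<Omega> (kernel_op \<Omega> ?a (wave z)) (wave z) = of_real (real (card \<Omega>) * symbol z ^ l) - E" .
  have "cmod E \<le> (\<Sum>x\<in>\<Omega>. \<Sum>y\<in>Y. \<bar>coeff_a l x y\<bar>)"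
    unfolding E_def by (intro sum_norm_le) (simp add: norm_mult)
  also have "\<dots> = (\<Sum>y\<in>Y. \<Sum>x\<in>\<Omega>. \<bar>coeff_a l x y\<bar>)"
    by (rule sum.swap)
  also have "\<dots> \<le> boundary_size l \<Omega>"
    using assms Y by (intro boundary_size_ge) auto
  finally have "- Re E \<le> boundary_size l \<Omega>"
    using abs_Re_le_cmod[of E] by linarith
  then show ?thesis unfolding eq by simp
qed

lemma kernel_op_coeff_a_0:
  fixes \<Omega> :: "(int ^ 'd::finite) set"
  assumes "finite \<Omega>" "supported \<Omega> f"
  shows "kernel_op \<Omega> (\<lambda>x y. complex_of_real (coeff_a 0 x y)) f = f"
proof -
  have "coeff_a 0 x y = (if x = y then 1 else 0)" for x y :: "int ^ 'd"
    by (simp add: coeff_a_def walks_0)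
  then show ?thesis
    using assms by (auto simp: kernel_op_def supported_def fun_eq_iff if_distrib[of complex_of_real]
        if_distrib[of "\<lambda>z. z * _"] cong: if_cong)
qed

text \<open>Indices start at \<open>0\<close> here: \<open>\<mu> i\<close> stands for the eigenvalue numbered \<open>Suc i\<close>.\<close>

locale dirichlet_eigenbasis =
  fixes \<Omega> :: "(int ^ 'd::finite) set" and l :: nat and \<phi> :: "nat \<Rightarrow> int ^ 'd \<Rightarrow> complex"
    and \<mu> :: "nat \<Rightarrow> real"
  assumes finite_domain: "finite \<Omega>"
    and orthonormal: "orthonormal_on \<Omega> (card \<Omega>) \<phi>"
    and eigen: "\<And>i x. i < card \<Omega> \<Longrightarrow>
      kernel_op \<Omega> (\<lambda>x y. complex_of_real (coeff_a l x y)) (\<phi> i) x = complex_of_real (\<mu> i) * \<phi> i x"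
    and mono: "\<And>i j. i \<le> j \<Longrightarrow> j < card \<Omega> \<Longrightarrow> \<mu> i \<le> \<mu> j"
begin

abbreviation n :: nat where "n \<equiv> card \<Omega>"

definition eigen_density :: "nat \<Rightarrow> real ^ 'd \<Rightarrow> real" where
  "eigen_density i z = (cmod (lattice_fourier \<Omega> (\<phi> i) z))\<^sup>2"

lemma eigen_density_nonneg: "0 \<le> eigen_density i z"
  by (simp add: eigen_density_def)

lemma continuous_on_eigen_density [continuous_intros]: "continuous_on A (eigen_density i)"
  unfolding eigen_density_def[abs_def] by (intro continuous_intros)

lemma eigen_density_conv_wave: "eigen_density i z = (cmod (inner_on \<Omega> (wave z) (\<phi> i)))\<^sup>2"
  unfolding eigen_density_def lattice_fourier_def by (subst inner_on_commute) simp

text \<open>Parseval for the restriction of \<open>wave z\<close> to \<open>\<Omega>\<close>, whose values all have modulus \<open>1\<close>.\<close>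

lemma sum_eigen_density: "(\<Sum>i<n. eigen_density i z) = real n"
  unfolding eigen_density_conv_wave orthonormal_parseval[OF finite_domain orthonormal] by simp

lemma integral_eigen_density_symbol:
  assumes "i < n"
  shows "(\<integral>z. symbol z ^ l * eigen_density i z \<partial>freq_measure) = (2 * pi) ^ CARD('d) * \<mu> i"
proof -
  have "kernel_op \<Omega> (\<lambda>x y. complex_of_real (coeff_a l x y)) (\<phi> i) = (\<lambda>x. complex_of_real (\<mu> i) * \<phi> i x)"
    using eigen[OF assms] by auto
  then have "inner_on \<Omega> (kernel_op \<Omega> (\<lambda>x y. complex_of_real (coeff_a l x y)) (\<phi> i)) (\<phi> i)
      = complex_of_real (\<mu> i) * inner_on \<Omega> (\<phi> i) (\<phi> i)"
    by (simp add: inner_on_def sum_distrib_left mult.assoc)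
  also have "inner_on \<Omega> (\<phi> i) (\<phi> i) = 1"
    using orthonormal assms by (simp add: orthonormal_on_def)
  finally have "(\<integral>z. complex_of_real (symbol z ^ l * eigen_density i z) \<partial>freq_measure)
      = of_real ((2 * pi) ^ CARD('d) * \<mu> i)"
    unfolding eigen_density_def plancherel_symbol[OF finite_domain]
    by (simp only: of_real_mult mult_1_right)
  then have "complex_of_real (\<integral>z. symbol z ^ l * eigen_density i z \<partial>freq_measure)
      = of_real ((2 * pi) ^ CARD('d) * \<mu> i)"
    by (simp only: integral_complex_of_real)
  then show ?thesis by (simp only: of_real_eq_iff)
qed

lemma integral_eigen_density:
  assumes "i < n"
  shows "(\<integral>z. eigen_density i z \<partial>freq_measure) = (2 * pi) ^ CARD('d)"
proof -
  have "supported \<Omega> (\<phi> i)" and "inner_on \<Omega> (\<phi> i) (\<phi> i) = 1"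
    using orthonormal assms by (auto simp: orthonormal_on_def)
  then have "(\<integral>z. complex_of_real (symbol z ^ 0 * eigen_density i z) \<partial>freq_measure) = of_real ((2 * pi) ^ CARD('d))"
    unfolding eigen_density_def plancherel_symbol[OF finite_domain]
    by (simp only: kernel_op_coeff_a_0[OF finite_domain] of_real_mult mult_1_right)
  then have "complex_of_real (\<integral>z. eigen_density i z \<partial>freq_measure) = of_real ((2 * pi) ^ CARD('d))"
    by (simp only: integral_complex_of_real power_0 mult_1)
  then show ?thesis by (simp only: of_real_eq_iff)
qed

lemma eigenvalue_nonneg: "i < n \<Longrightarrow> 0 \<le> \<mu> i"
proof -
  assume "i < n"
  have "0 \<le> (\<integral>z. symbol z ^ l * eigen_density i z \<partial>freq_measure)"
    by (intro Bochner_Integration.integral_nonneg mult_nonneg_nonneg zero_le_power symbol_nonneg eigen_density_nonneg)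
  then show ?thesis
    unfolding integral_eigen_density_symbol[OF \<open>i < n\<close>]
    by (meson zero_le_mult_iff not_le zero_less_power mult_pos_pos pi_gt_zero zero_less_numeral)
qed

definition ball_weight :: "real \<Rightarrow> nat \<Rightarrow> real" where
  "ball_weight r i = (\<integral>z. indicator (cball 0 r) z * eigen_density i z \<partial>freq_measure)"

lemma ball_weight_nonneg: "0 \<le> ball_weight r i"
  unfolding ball_weight_def
  by (intro Bochner_Integration.integral_nonneg mult_nonneg_nonneg eigen_density_nonneg) auto

lemma ball_weight_le: "i < n \<Longrightarrow> ball_weight r i \<le> (2 * pi) ^ CARD('d)"
  unfolding ball_weight_def integral_eigen_density[symmetric]
  by (intro integral_mono integrable_freq_measure_cball integrable_freq_measure continuous_intros)
     (auto simp: indicator_def eigen_density_nonneg)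

lemma sum_ball_weight:
  assumes "0 \<le> r" "r \<le> pi"
  shows "(\<Sum>i<n. ball_weight r i) = real n * (unit_ball_vol (real CARD('d)) * r ^ CARD('d))"
proof -
  have "(\<Sum>i<n. ball_weight r i) = (\<integral>z. (\<Sum>i<n. indicator (cball 0 r) z * eigen_density i z) \<partial>freq_measure)"
    unfolding ball_weight_def
    by (intro Bochner_Integration.integral_sum[symmetric] integrable_freq_measure_cball continuous_intros)
  also have "\<dots> = real n * (\<integral>z. indicator (cball 0 r) z * norm z ^ 0 \<partial>(freq_measure :: (real ^ 'd) measure))"
    by (simp add: sum_distrib_left[symmetric] sum_eigen_density mult.commute)
  also have "\<dots> = real n * (unit_ball_vol (real CARD('d)) * r ^ CARD('d))"
    by (subst freq_measure_ball_moment[OF assms]) simp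
  finally show ?thesis .
qed

text \<open>The integral of the pointwise bound \<open>wave_energy_le\<close> over the ball, with the symbol replaced by
  the larger \<open>|z|\<^sup>2\<close>.\<close>

lemma weighted_eigenvalue_sum_le:
  assumes "0 \<le> r" "r \<le> pi"
  shows "(\<Sum>i<n. \<mu> i * ball_weight r i)
    \<le> unit_ball_vol (real CARD('d)) * r ^ CARD('d) * (real n * (real CARD('d) / real (CARD('d) + 2 * l)) * r ^ (2 * l) + boundary_size l \<Omega>)"
proof -
  let ?I = "\<lambda>z :: real ^ 'd. indicator (cball 0 r) z :: real"
  have energy: "(\<Sum>i<n. \<mu> i * eigen_density i z) \<le> real n * norm z ^ (2 * l) + boundary_size l \<Omega>" for z
  proof -
    have "(\<Sum>i<n. \<mu> i * eigen_density i z)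
        = Re (inner_on \<Omega> (kernel_op \<Omega> (\<lambda>x y. complex_of_real (coeff_a l x y)) (wave z)) (wave z))"
      by (subst inner_on_kernel_op_spectral[OF finite_domain orthonormal, where \<mu> = \<mu>])
         (simp_all add: eigen eigen_density_conv_wave)
    also have "\<dots> \<le> real n * symbol z ^ l + boundary_size l \<Omega>"
      by (rule wave_energy_le[OF finite_domain])
    also have "symbol z ^ l \<le> norm z ^ (2 * l)"
      unfolding power_mult by (intro power_mono symbol_le symbol_nonneg)
    finally show ?thesis by (simp add: mult_left_mono)
  qed
  have "(\<Sum>i<n. \<mu> i * ball_weight r i) = (\<integral>z. (\<Sum>i<n. \<mu> i * (?I z * eigen_density i z)) \<partial>freq_measure)"
    unfolding ball_weight_def
    by (subst Bochner_Integration.integral_sum)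
       (auto intro!: integrable_freq_measure_cball continuous_intros)
  also have "\<dots> \<le> (\<integral>z. real n * (?I z * norm z ^ (2 * l)) + boundary_size l \<Omega> * (?I z * norm z ^ 0) \<partial>freq_measure)"
  proof (intro integral_mono Bochner_Integration.integrable_sum Bochner_Integration.integrable_add
      integrable_mult_right integrable_freq_measure_cball continuous_intros)
    fix z :: "real ^ 'd"
    have "(\<Sum>i<n. \<mu> i * (?I z * eigen_density i z)) = ?I z * (\<Sum>i<n. \<mu> i * eigen_density i z)"
      by (simp add: sum_distrib_left mult_ac)
    also have "\<dots> \<le> ?I z * (real n * norm z ^ (2 * l) + boundary_size l \<Omega>)"
      using energy by (intro mult_left_mono) auto
    finally show "(\<Sum>i<n. \<mu> i * (?I z * eigen_density i z))
        \<le> real n * (?I z * norm z ^ (2 * l)) + boundary_size l \<Omega> * (?I z * norm z ^ 0)"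
      by (simp add: algebra_simps)
  qed
  also have "\<dots> = real n * (\<integral>z. ?I z * norm z ^ (2 * l) \<partial>freq_measure)
      + boundary_size l \<Omega> * (\<integral>z. ?I z * norm z ^ 0 \<partial>freq_measure)"
    by (subst Bochner_Integration.integral_add)
       (auto intro!: integrable_mult_right integrable_freq_measure_cball continuous_intros
         simp del: power_0)
  also have "\<dots> = unit_ball_vol (real CARD('d)) * r ^ CARD('d) * (real n * (real CARD('d) / real (CARD('d) + 2 * l)) * r ^ (2 * l) + boundary_size l \<Omega>)"
    unfolding freq_measure_ball_moment[OF assms] by (simp add: power_add algebra_simps)
  finally show ?thesis .
qed

text \<open>The radius is tied to \<open>k\<close> by \<open>vol\<close>: the ball weights add up to exactly \<open>k\<close> times their
  upper bound \<open>(2\<pi>)\<^sup>d\<close>.\<close>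

lemma eigenvalue_sum_le:
  assumes r: "0 \<le> r" "r \<le> pi" and k: "1 \<le> k" "k \<le> n"
    and vol: "real n * (unit_ball_vol (real CARD('d)) * r ^ CARD('d)) = (2 * pi) ^ CARD('d) * real k"
  shows "(\<Sum>i<k. \<mu> i) / real k
    \<le> real CARD('d) / real (CARD('d) + 2 * l) * r ^ (2 * l) + boundary_size l \<Omega> / real n"
proof -
  let ?A = "real CARD('d) / real (CARD('d) + 2 * l) * r ^ (2 * l)"
  have n: "real n > 0" using k by linarith
  have "(2 * pi) ^ CARD('d) * (\<Sum>i<k. \<mu> i) \<le> (\<Sum>i<n. \<mu> i * ball_weight r i)"
    using k ball_weight_nonneg ball_weight_le sum_ball_weight[OF r] vol mono
    by (intro weighted_sum_ge_initial_sum) auto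
  also have "\<dots> \<le> unit_ball_vol (real CARD('d)) * r ^ CARD('d) * (real n * ?A + boundary_size l \<Omega>)"
    using weighted_eigenvalue_sum_le[OF r] by (simp add: mult.assoc)
  also have "\<dots> = (real n * (unit_ball_vol (real CARD('d)) * r ^ CARD('d))) * (?A + boundary_size l \<Omega> / real n)"
    using n by (simp add: field_simps)
  also have "\<dots> = (2 * pi) ^ CARD('d) * (real k * (?A + boundary_size l \<Omega> / real n))"
    unfolding vol by simp
  finally have "(\<Sum>i<k. \<mu> i) \<le> real k * (?A + boundary_size l \<Omega> / real n)"
    by (simp only: mult_le_cancel_left_pos zero_less_power mult_pos_pos pi_gt_zero zero_less_numeral)
  then show ?thesis using k by (simp add: divide_le_eq mult.commute)
qed

text \<open>Now the ball weights add up to \<open>2k\<close> times their upper bound, and the first \<open>k\<close> of them account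
  for at most half of that. What is left for the indices from \<open>k\<close> on carries eigenvalues that are
  at least \<open>\<mu> k\<close>. The count also shows \<open>2k \<le> n\<close>, so that \<open>\<mu> k\<close> is a genuine eigenvalue.\<close>

lemma eigenvalue_le:
  assumes r: "0 \<le> r" "r \<le> pi" and k: "1 \<le> k"
    and vol: "real n * (unit_ball_vol (real CARD('d)) * r ^ CARD('d)) = (2 * pi) ^ CARD('d) * (2 * real k)"
  shows "\<mu> k \<le> 2 * (real CARD('d) / real (CARD('d) + 2 * l) * r ^ (2 * l) + boundary_size l \<Omega> / real n)"
proof -
  let ?A = "real CARD('d) / real (CARD('d) + 2 * l) * r ^ (2 * l)" and ?c = "(2 * pi) ^ CARD('d)"
  have c: "?c > 0" by simp
  \<comment> \<open>all \<open>n\<close> weights together reach \<open>2k\<close> times the upper bound of a single one, hence \<open>2k \<le> n\<close>\<close>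
  have "?c * (2 * real k) \<le> (\<Sum>i<n. ?c)"
    unfolding vol[symmetric] sum_ball_weight[OF r, symmetric] by (intro sum_mono ball_weight_le) simp
  also have "\<dots> = ?c * real n" by simp
  finally have "2 * real k \<le> real n" using c by (simp only: mult_le_cancel_left_pos)
  then have kn: "k < n" and n: "real n > 0" using k by linarith+
  have "(\<Sum>i<n. ball_weight r i) = (\<Sum>i<k. ball_weight r i) + (\<Sum>i\<in>{k..<n}. ball_weight r i)"
    using kn by (subst sum.union_disjoint[symmetric]) (auto intro!: sum.cong)
  moreover have "(\<Sum>i<k. ball_weight r i) \<le> (\<Sum>i<k. ?c)"
    using kn by (intro sum_mono ball_weight_le) simp
  moreover have "(\<Sum>i<k. ?c) = ?c * real k" by simp
  moreover have "(\<Sum>i<n. ball_weight r i) = ?c * real k + ?c * real k"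
    unfolding sum_ball_weight[OF r] vol by (simp only: mult_2 distrib_left)
  ultimately have tail: "?c * real k \<le> (\<Sum>i\<in>{k..<n}. ball_weight r i)"
    by linarith
  have "\<mu> k * (?c * real k) \<le> \<mu> k * (\<Sum>i\<in>{k..<n}. ball_weight r i)"
    by (intro mult_left_mono tail eigenvalue_nonneg kn)
  also have "\<dots> \<le> (\<Sum>i\<in>{k..<n}. \<mu> i * ball_weight r i)"
    unfolding sum_distrib_left using mono ball_weight_nonneg by (intro sum_mono mult_right_mono) auto
  also have "\<dots> \<le> (\<Sum>i<n. \<mu> i * ball_weight r i)"
    using eigenvalue_nonneg ball_weight_nonneg by (intro sum_mono2) auto
  also have "\<dots> \<le> unit_ball_vol (real CARD('d)) * r ^ CARD('d) * (real n * ?A + boundary_size l \<Omega>)"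
    using weighted_eigenvalue_sum_le[OF r] by (simp add: mult.assoc)
  also have "\<dots> = (real n * (unit_ball_vol (real CARD('d)) * r ^ CARD('d))) * (?A + boundary_size l \<Omega> / real n)"
    using n by (simp add: field_simps)
  also have "\<dots> = (?c * real k) * (2 * (?A + boundary_size l \<Omega> / real n))"
    unfolding vol by simp
  finally have "(?c * real k) * \<mu> k \<le> (?c * real k) * (2 * (?A + boundary_size l \<Omega> / real n))"
    by (simp only: mult.commute)
  moreover have "?c * real k > 0" using c k by simp
  ultimately show ?thesis by (simp only: mult_le_cancel_left_pos)
qed

lemma minorant_ball_integral:
  assumes "0 \<le> r" "r \<le> sqrt 6"
  shows "(\<integral>z. indicator (cball 0 r) z * minorant ((norm z)\<^sup>2) ^ l \<partial>(freq_measure :: (real ^ 'd) measure))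
    = unit_ball_vol (real CARD('d)) * r ^ CARD('d) * (\<Sum>m\<le>l. real (l choose m) * (- 1 / 12) ^ m * (real CARD('d) / real (CARD('d) + 2 * (l + m))) * r ^ (2 * (l + m)))"
proof -
  let ?I = "\<lambda>z :: real ^ 'd. indicator (cball 0 r) z :: real"
  let ?b = "\<lambda>m. real (l choose m) * (- 1 / 12) ^ m"
  have rpi: "r \<le> pi" using assms sqrt6_le_pi by linarith
  have "?I z * minorant ((norm z)\<^sup>2) ^ l = (\<Sum>m\<le>l. ?b m * (?I z * norm z ^ (2 * (l + m))))" for z
  proof (cases "norm z \<le> r")
    case True
    then have "(norm z)\<^sup>2 \<le> 6"
      using assms by (intro sqrt_ge_absD) simp
    then have "minorant ((norm z)\<^sup>2) = (- 1 / 12) * (norm z)^4 + (norm z)\<^sup>2"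
      by (simp add: minorant_eq flip: power_mult)
    then have "minorant ((norm z)\<^sup>2) ^ l
        = (\<Sum>m\<le>l. real (l choose m) * ((- 1 / 12) * (norm z)^4) ^ m * ((norm z)\<^sup>2) ^ (l - m))"
      by (simp only: binomial_ring)
    also have "\<dots> = (\<Sum>m\<le>l. ?b m * norm z ^ (2 * (l + m)))"
    proof (intro sum.cong refl)
      fix m assume "m \<in> {..l}"
      then have "4 * m + 2 * (l - m) = 2 * (l + m)" by simp
      then have "((norm z)^4) ^ m * ((norm z)\<^sup>2) ^ (l - m) = norm z ^ (2 * (l + m))"
        by (metis power_add power_mult)
      then show "real (l choose m) * ((- 1 / 12) * (norm z)^4) ^ m * ((norm z)\<^sup>2) ^ (l - m)
          = ?b m * norm z ^ (2 * (l + m))"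
        by (simp only: power_mult_distrib mult.assoc)
    qed
    finally show ?thesis using True by simp
  qed simp
  then have "(\<integral>z. ?I z * minorant ((norm z)\<^sup>2) ^ l \<partial>freq_measure)
      = (\<Sum>m\<le>l. ?b m * (\<integral>z. ?I z * norm z ^ (2 * (l + m)) \<partial>freq_measure))"
    by (simp only:)
       (subst Bochner_Integration.integral_sum, auto intro!: integrable_mult_right integrable_freq_measure_cball continuous_intros)
  also have "\<dots> = (\<Sum>m\<le>l. unit_ball_vol (real CARD('d)) * r ^ CARD('d) * (?b m * (real CARD('d) / real (CARD('d) + 2 * (l + m))) * r ^ (2 * (l + m))))"
    unfolding freq_measure_ball_moment[OF assms(1) rpi] by (intro sum.cong refl) (simp add: power_add)
  finally show ?thesis by (simp add: sum_distrib_left)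
qed

text \<open>On the ball the integrand is at least \<open>(|z|\<^sup>2/2) ^ l\<close>, whose integral is a positive moment.\<close>

lemma minorant_ball_integral_pos:
  assumes "0 < r" "r \<le> sqrt 6"
  shows "0 < (\<integral>z. indicator (cball 0 r) z * minorant ((norm z)\<^sup>2) ^ l \<partial>(freq_measure :: (real ^ 'd) measure))"
proof -
  let ?I = "\<lambda>z :: real ^ 'd. indicator (cball 0 r) z :: real"
  have rpi: "r \<le> pi" using assms sqrt6_le_pi by linarith
  have "0 < (1 / 2) ^ l * (real CARD('d) / real (CARD('d) + 2 * l) * unit_ball_vol (real CARD('d)) * r ^ (CARD('d) + 2 * l))"
    using assms by (simp add: add_pos_nonneg)
  also have "\<dots> = (\<integral>z. (1 / 2) ^ l * (?I z * norm z ^ (2 * l)) \<partial>freq_measure)"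
    using freq_measure_ball_moment[of r "2 * l", where 'd = 'd] assms rpi by simp
  also have "\<dots> \<le> (\<integral>z. ?I z * minorant ((norm z)\<^sup>2) ^ l \<partial>freq_measure)"
  proof (rule integral_mono)
    show "integrable freq_measure (\<lambda>z. (1 / 2) ^ l * (?I z * norm z ^ (2 * l)))"
      by (rule integrable_mult_right, rule integrable_freq_measure_cball) (intro continuous_intros)
    show "integrable freq_measure (\<lambda>z. ?I z * minorant ((norm z)\<^sup>2) ^ l)"
      by (rule integrable_freq_measure_cball) (intro continuous_intros)
    fix z :: "real ^ 'd"
    show "(1 / 2) ^ l * (?I z * norm z ^ (2 * l)) \<le> ?I z * minorant ((norm z)\<^sup>2) ^ l"
    proof (cases "norm z \<le> r")
      case True
      then have le6: "(norm z)\<^sup>2 \<le> 6"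
        using assms by (intro sqrt_ge_absD) simp
      have "(norm z)\<^sup>2 * (norm z)\<^sup>2 \<le> (norm z)\<^sup>2 * 6"
        using le6 by (intro mult_left_mono) auto
      with le6 have "(norm z)\<^sup>2 / 2 \<le> minorant ((norm z)\<^sup>2)"
        by (simp add: minorant_eq power2_eq_square[of "(norm z)\<^sup>2"])
      then have "((norm z)\<^sup>2 / 2) ^ l \<le> minorant ((norm z)\<^sup>2) ^ l"
        by (intro power_mono) auto
      then show ?thesis using True by (simp add: power_divide power_mult)
    qed simp
  qed
  finally show ?thesis .
qed

text \<open>Let \<open>W z = minorant (|z|\<^sup>2) ^ l\<close>, let \<open>W\<^sub>r\<close> be its value on the sphere of radius \<open>r\<close> and \<open>F\<close> the
  sum of the first \<open>k\<close> densities. Inside the ball \<open>W \<le> W\<^sub>r\<close> and \<open>F \<le> n\<close>, outside it \<open>W \<ge> W\<^sub>r\<close> and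
  \<open>F \<ge> 0\<close>, so \<open>(W - W\<^sub>r) (F - n 1\<^sub>B) \<ge> 0\<close> everywhere. In the integral of this product the
  terms with \<open>W\<^sub>r\<close> cancel, because \<open>vol\<close> gives \<open>F\<close> and \<open>n 1\<^sub>B\<close> the same integral.\<close>

lemma eigenvalue_sum_ge:
  assumes r: "0 \<le> r" "r \<le> sqrt 6" and k: "1 \<le> k" "k \<le> n"
    and vol: "real n * (unit_ball_vol (real CARD('d)) * r ^ CARD('d)) = (2 * pi) ^ CARD('d) * real k"
  shows "(\<Sum>m\<le>l. real (l choose m) * (- 1 / 12) ^ m * (real CARD('d) / real (CARD('d) + 2 * (l + m))) * r ^ (2 * (l + m)))
    \<le> (\<Sum>i<k. \<mu> i) / real k"
proof -
  let ?S = "\<Sum>m\<le>l. real (l choose m) * (- 1 / 12) ^ m * (real CARD('d) / real (CARD('d) + 2 * (l + m))) * r ^ (2 * (l + m))"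
  let ?c = "(2 * pi) ^ CARD('d)"
  let ?I = "\<lambda>z :: real ^ 'd. indicator (cball 0 r) z :: real"
  let ?W = "\<lambda>z :: real ^ 'd. minorant ((norm z)\<^sup>2) ^ l" and ?Wr = "minorant (r\<^sup>2) ^ l"
  let ?F = "\<lambda>z. \<Sum>i<k. eigen_density i z"
  have rpi: "r \<le> pi" using r sqrt6_le_pi by linarith
  have intF: "(\<integral>z. ?F z \<partial>freq_measure) = ?c * real k"
    using k by (subst Bochner_Integration.integral_sum)
      (auto simp: integral_eigen_density intro!: integrable_freq_measure continuous_intros)
  have intI: "real n * (\<integral>z. ?I z * 1 \<partial>freq_measure) = ?c * real k"
    using freq_measure_ball_moment[OF r(1) rpi, of 0, where 'd = 'd] vol by simp
  have F_le: "?F z \<le> real n" for z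
    unfolding sum_eigen_density[of z, symmetric] using k eigen_density_nonneg by (intro sum_mono2) auto
  have F_nonneg: "0 \<le> ?F z" for z
    by (intro sum_nonneg eigen_density_nonneg)
  have cont: "continuous_on UNIV ?W" "continuous_on UNIV ?F"
    by (intro continuous_intros)+
  have int: "integrable freq_measure (\<lambda>z. real n * (?I z * ?W z))"
    "integrable freq_measure (\<lambda>z. ?Wr * ?F z)"
    "integrable freq_measure (\<lambda>z. ?W z * ?F z)"
    "integrable freq_measure (\<lambda>z. ?Wr * (real n * (?I z * 1)))"
    by (rule integrable_mult_right, rule integrable_freq_measure_cball, rule cont,
        rule integrable_mult_right, rule integrable_freq_measure, rule cont,
        rule integrable_freq_measure, rule continuous_on_mult, rule cont, rule cont,
        rule integrable_mult_right, rule integrable_mult_right, rule integrable_freq_measure_cball,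
        rule continuous_on_const)
  have "real n * (unit_ball_vol (real CARD('d)) * r ^ CARD('d) * ?S) + ?Wr * (?c * real k)
      = (\<integral>z. real n * (?I z * ?W z) + ?Wr * ?F z \<partial>freq_measure)"
    unfolding Bochner_Integration.integral_add[OF int(1,2)]
    by (simp only: integral_mult_right_zero minorant_ball_integral[OF r] intF)
  also have "\<dots> \<le> (\<integral>z. ?W z * ?F z + ?Wr * (real n * (?I z * 1)) \<partial>freq_measure)"
  proof (rule integral_mono[OF Bochner_Integration.integrable_add[OF int(1,2)]
        Bochner_Integration.integrable_add[OF int(3,4)]])
    fix z :: "real ^ 'd"
    have "0 \<le> (?W z - ?Wr) * (?F z - real n * ?I z)"
    proof (cases "norm z \<le> r")
      case True
      then have "?W z \<le> ?Wr"
        by (intro power_mono minorant_mono minorant_nonneg) auto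
      with F_le[of z] True show ?thesis by (intro mult_nonpos_nonpos) auto
    next
      case False
      then have "?Wr \<le> ?W z"
        using r by (intro power_mono minorant_mono minorant_nonneg) auto
      with F_nonneg[of z] False show ?thesis by (intro mult_nonneg_nonneg) auto
    qed
    then show "real n * (?I z * ?W z) + ?Wr * ?F z \<le> ?W z * ?F z + ?Wr * (real n * (?I z * 1))"
      by (simp add: algebra_simps)
  qed
  also have "\<dots> = (\<integral>z. ?W z * ?F z \<partial>freq_measure) + ?Wr * (?c * real k)"
    unfolding Bochner_Integration.integral_add[OF int(3,4)]
    by (simp only: integral_mult_right_zero intI)
  finally have "real n * (unit_ball_vol (real CARD('d)) * r ^ CARD('d) * ?S) \<le> (\<integral>z. ?W z * ?F z \<partial>freq_measure)" by simp
  also have "\<dots> \<le> (\<integral>z. (\<Sum>i<k. symbol z ^ l * eigen_density i z) \<partial>freq_measure)"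
  proof (rule integral_mono[OF int(3)])
    show "integrable freq_measure (\<lambda>z. \<Sum>i<k. symbol z ^ l * eigen_density i z)"
      by (rule integrable_freq_measure) (intro continuous_intros)
    fix z :: "real ^ 'd" assume "z \<in> space freq_measure"
    then have "?W z \<le> symbol z ^ l"
      by (intro power_mono minorant_le_symbol minorant_nonneg) auto
    then show "?W z * ?F z \<le> (\<Sum>i<k. symbol z ^ l * eigen_density i z)"
      unfolding sum_distrib_left[symmetric] by (intro mult_right_mono F_nonneg)
  qed
  also have "\<dots> = (\<Sum>i<k. ?c * \<mu> i)"
    using k by (subst Bochner_Integration.integral_sum)
      (auto simp: integral_eigen_density_symbol intro!: integrable_freq_measure continuous_intros)
  finally have "(real n * (unit_ball_vol (real CARD('d)) * r ^ CARD('d))) * ?S \<le> ?c * (\<Sum>i<k. \<mu> i)"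
    by (simp add: sum_distrib_left mult.assoc)
  then have "?c * (real k * ?S) \<le> ?c * (\<Sum>i<k. \<mu> i)"
    unfolding vol by (simp only: mult.assoc)
  then have "real k * ?S \<le> (\<Sum>i<k. \<mu> i)"
    by (simp only: mult_le_cancel_left_pos zero_less_power mult_pos_pos pi_gt_zero zero_less_numeral)
  then show ?thesis using k by (simp add: le_divide_eq mult.commute)
qed

end

text \<open>The radius at which \<open>N\<close> times the volume of the ball is \<open>(2\<pi>)\<^sup>d K\<close>. The last property translates
  the ranges of \<open>k\<close> in the theorem into \<open>r \<le> \<pi>\<close> and \<open>r \<le> \<surd>6\<close>.\<close>

lemma fermi_radius_exists:
  fixes V K N :: real and d :: nat
  assumes "d > 0" "N > 0" "V > 0" "K > 0"
  obtains r where "r > 0" "N * (V * r ^ d) = (2 * pi) ^ d * K"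
    "\<And>j. r ^ (2 * j) = (2 * pi) ^ (2 * j) * (K / (V * N)) powr (real (2 * j) / real d)"
    "\<And>s. 0 \<le> s \<Longrightarrow> K \<le> (s / (2 * pi)) ^ d * V * N \<Longrightarrow> r \<le> s"
proof -
  define q where "q = K / (V * N)"
  have q: "q > 0" using assms by (simp add: q_def)
  have pw: "(q powr (1 / real d)) ^ j = q powr (real j / real d)" for j
    using q by (simp add: powr_powr flip: powr_realpow)
  define r where "r = 2 * pi * q powr (1 / real d)"
  have r: "r > 0" using q by (simp add: r_def)
  have rd: "r ^ d = (2 * pi) ^ d * q"
    using q assms(1) by (simp only: r_def power_mult_distrib pw) simp
  show ?thesis
  proof (rule that[OF r])
    show "N * (V * r ^ d) = (2 * pi) ^ d * K"
      unfolding rd using assms by (simp add: q_def)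
    show "r ^ (2 * j) = (2 * pi) ^ (2 * j) * (K / (V * N)) powr (real (2 * j) / real d)" for j
      by (simp only: r_def power_mult_distrib[of "2 * pi"] pw) (simp only: q_def)
    show "r \<le> s" if "0 \<le> s" "K \<le> (s / (2 * pi)) ^ d * V * N" for s
    proof -
      have "q \<le> (s / (2 * pi)) ^ d"
        using that(2) assms by (simp add: q_def divide_le_eq mult.assoc)
      then have "r ^ d \<le> (2 * pi) ^ d * (s / (2 * pi)) ^ d"
        unfolding rd by (intro mult_left_mono) auto
      also have "\<dots> = (2 * pi * (s / (2 * pi))) ^ d"
        by (rule power_mult_distrib[symmetric])
      also have "2 * pi * (s / (2 * pi)) = s" by simp
      finally show ?thesis
        using assms(1) that(1) r by (simp add: power_mono_iff)
    qed
  qed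
qed

theorem theorem1p1:
  fixes \<Omega> :: "(int ^ 'd::finite) set" and l d :: nat and V :: real
  assumes "l \<ge> 1"
    and "d = CARD('d)"
    and "V = measure lborel (ball (0 :: real ^ 'd) 1)"
    and "finite \<Omega>"
  shows
    "(\<forall>k::nat. 1 \<le> k \<and> real k \<le> min 1 (V / 2 ^ d) * real (card \<Omega>) \<longrightarrow>
        1 / real k * (\<Sum>j=1..k. dirichlet_eigenvalue l \<Omega> j)
          \<le> (2 * pi) ^ (2 * l) * (real d / real (d + 2 * l))
              * (real k / (V * real (card \<Omega>))) powr (real (2 * l) / real d)
            + boundary_size l \<Omega> / real (card \<Omega>))
     \<and> (\<forall>k::nat. 1 \<le> k \<and> real k \<le> min 1 (V / 2 ^ (d + 1)) * real (card \<Omega>) \<longrightarrow>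
        dirichlet_eigenvalue l \<Omega> (k + 1)
          \<le> (2 * pi) ^ (2 * l) * (real d * 2 powr (real (d + 2 * l) / real d) / real (d + 2 * l))
              * (real k / (V * real (card \<Omega>))) powr (real (2 * l) / real d)
            + 2 * (boundary_size l \<Omega> / real (card \<Omega>)))
     \<and> boundary_size l \<Omega> \<le> 4 ^ l * real d ^ l * (\<Sum>i=1..l. real (card (boundary_layer i \<Omega>)))
     \<and> (\<forall>k::nat. 1 \<le> k \<and> real k \<le> min 1 ((sqrt 6 / (2 * pi)) ^ d * V) * real (card \<Omega>) \<longrightarrow>
        dirichlet_eigenvalue l \<Omega> k \<ge> 1 / real k * (\<Sum>j=1..k. dirichlet_eigenvalue l \<Omega> j)
        \<and> 1 / real k * (\<Sum>j=1..k. dirichlet_eigenvalue l \<Omega> j)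
           \<ge> (\<Sum>m=0..l. real (l choose m) * (- 1 / 12) ^ m * (2 * pi) ^ (2 * (l + m))
                * (real d / real (d + 2 * (l + m)))
                * (real k / (V * real (card \<Omega>))) powr (real (2 * (l + m)) / real d))
        \<and> (\<Sum>m=0..l. real (l choose m) * (- 1 / 12) ^ m * (2 * pi) ^ (2 * (l + m))
                * (real d / real (d + 2 * (l + m)))
                * (real k / (V * real (card \<Omega>))) powr (real (2 * (l + m)) / real d)) > 0)"
proof -
  let ?n = "card \<Omega>" and ?\<mu> = "\<lambda>i. dirichlet_eigenvalue l \<Omega> (Suc i)"
  obtain \<phi> where on: "orthonormal_on \<Omega> ?n \<phi>"
    and eig: "\<And>i x. i < ?n \<Longrightarrow> kernel_op \<Omega> (\<lambda>x y. complex_of_real (coeff_a l x y)) (\<phi> i) x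
       = complex_of_real (?\<mu> i) * \<phi> i x"
    and mono: "\<And>i j. i \<le> j \<Longrightarrow> j < ?n \<Longrightarrow> ?\<mu> i \<le> ?\<mu> j"
    using dirichlet_spectral[OF assms(4), of l] by blast
  interpret dirichlet_eigenbasis \<Omega> l \<phi> ?\<mu>
    by unfold_locales (fact assms(4), fact on, fact eig, fact mono)
  have V: "V = unit_ball_vol (real CARD('d))"
    using content_ball[of 1 "0 :: real ^ 'd"] assms(3) by simp
  have V0: "V > 0" unfolding V by simp
  have d0: "d > 0" using assms(2) by simp
  have vol: "real ?n * (unit_ball_vol (real CARD('d)) * r ^ CARD('d)) = (2 * pi) ^ CARD('d) * K"
    if "real ?n * (V * r ^ d) = (2 * pi) ^ d * K" for r K
    using that unfolding V assms(2) .
  have sum_eq: "1 / real k * (\<Sum>j=1..k. dirichlet_eigenvalue l \<Omega> j) = (\<Sum>i<k. ?\<mu> i) / real k" for k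
    using sum.atLeast1_atMost_eq[of "dirichlet_eigenvalue l \<Omega>" k] by simp
  have min_le: "real k \<le> real ?n" "real k \<le> c * real ?n" if "real k \<le> min 1 c * real ?n" for k :: nat and c
  proof -
    have "min 1 c * real ?n \<le> 1 * real ?n" "min 1 c * real ?n \<le> c * real ?n"
      by (intro mult_right_mono; simp)+
    with that show "real k \<le> real ?n" "real k \<le> c * real ?n" by linarith+
  qed
  have half: "(pi / (2 * pi)) ^ d = 1 / 2 ^ d"
    by (simp add: power_divide)
  show ?thesis
  proof (intro conjI allI impI; (elim conjE)?)
    fix k :: nat assume k: "1 \<le> k" "real k \<le> min 1 (V / 2 ^ d) * real ?n"
    have kn: "k \<le> ?n" and n0: "real ?n > 0" and kV: "real k \<le> V / 2 ^ d * real ?n"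
      using min_le[OF k(2)] k(1) by auto
    obtain r where r: "r > 0" "real ?n * (V * r ^ d) = (2 * pi) ^ d * real k"
      "\<And>j. r ^ (2 * j) = (2 * pi) ^ (2 * j) * (real k / (V * real ?n)) powr (real (2 * j) / real d)"
      "\<And>s. 0 \<le> s \<Longrightarrow> real k \<le> (s / (2 * pi)) ^ d * V * real ?n \<Longrightarrow> r \<le> s"
      using fermi_radius_exists[OF d0 n0 V0, of "real k"] k(1) by auto
    have "r \<le> pi" using r(4)[of pi] kV by (simp only: half) simp
    with eigenvalue_sum_le[of r k] r(1) k(1) kn vol[OF r(2)]
    have "(\<Sum>i<k. ?\<mu> i) / real k \<le> real CARD('d) / real (CARD('d) + 2 * l) * r ^ (2 * l) + boundary_size l \<Omega> / real ?n"
      by simp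
    then show "1 / real k * (\<Sum>j=1..k. dirichlet_eigenvalue l \<Omega> j)
          \<le> (2 * pi) ^ (2 * l) * (real d / real (d + 2 * l))
              * (real k / (V * real ?n)) powr (real (2 * l) / real d)
            + boundary_size l \<Omega> / real ?n"
      unfolding sum_eq r(3) assms(2) by (simp only: mult_ac)
  next
    fix k :: nat assume k: "1 \<le> k" "real k \<le> min 1 (V / 2 ^ (d + 1)) * real ?n"
    have n0: "real ?n > 0" and kV: "real k \<le> V / 2 ^ (d + 1) * real ?n"
      using min_le[OF k(2)] k(1) by auto
    obtain r where r: "r > 0" "real ?n * (V * r ^ d) = (2 * pi) ^ d * (2 * real k)"
      "\<And>j. r ^ (2 * j) = (2 * pi) ^ (2 * j) * (2 * real k / (V * real ?n)) powr (real (2 * j) / real d)"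
      "\<And>s. 0 \<le> s \<Longrightarrow> 2 * real k \<le> (s / (2 * pi)) ^ d * V * real ?n \<Longrightarrow> r \<le> s"
      using fermi_radius_exists[OF d0 n0 V0, of "2 * real k"] k(1) by auto
    have "r \<le> pi" using r(4)[of pi] kV by (simp only: half) simp
    with eigenvalue_le[of r k] r(1) k(1) vol[OF r(2)]
    have le: "?\<mu> k \<le> 2 * (real d / real (d + 2 * l) * r ^ (2 * l) + boundary_size l \<Omega> / real ?n)"
      unfolding assms(2) by simp
    have "(2 :: real) powr (real (d + 2 * l) / real d) = 2 * 2 powr (real (2 * l) / real d)"
      using d0 by (simp add: add_divide_distrib powr_add)
    moreover have "(2 * real k / (V * real ?n)) powr (real (2 * l) / real d)
        = 2 powr (real (2 * l) / real d) * (real k / (V * real ?n)) powr (real (2 * l) / real d)"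
      using V0 by (simp flip: powr_mult)
    ultimately have "2 * (real d / real (d + 2 * l) * r ^ (2 * l))
        = (2 * pi) ^ (2 * l) * (real d * 2 powr (real (d + 2 * l) / real d) / real (d + 2 * l))
              * (real k / (V * real ?n)) powr (real (2 * l) / real d)"
      unfolding r(3) by (simp only: mult_ac times_divide_eq_left times_divide_eq_right)
    with le show "dirichlet_eigenvalue l \<Omega> (k + 1)
          \<le> (2 * pi) ^ (2 * l) * (real d * 2 powr (real (d + 2 * l) / real d) / real (d + 2 * l))
              * (real k / (V * real ?n)) powr (real (2 * l) / real d)
            + 2 * (boundary_size l \<Omega> / real ?n)"
      by (simp only: Suc_eq_plus1 distrib_left)
  next
    show "boundary_size l \<Omega> \<le> 4 ^ l * real d ^ l * (\<Sum>i=1..l. real (card (boundary_layer i \<Omega>)))"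
      unfolding assms(2) by (rule boundary_size_le[OF assms(4)])
  next
    fix k :: nat assume k: "1 \<le> k" "real k \<le> min 1 ((sqrt 6 / (2 * pi)) ^ d * V) * real ?n"
    have kn: "k \<le> ?n" using min_le[OF k(2)] by simp
    have "(\<Sum>i<k. ?\<mu> i) \<le> (\<Sum>i<k. dirichlet_eigenvalue l \<Omega> k)"
      using mono[of _ "k - 1"] k(1) kn by (intro sum_mono) auto
    then show "1 / real k * (\<Sum>j=1..k. dirichlet_eigenvalue l \<Omega> j) \<le> dirichlet_eigenvalue l \<Omega> k"
      unfolding sum_eq using k(1) by (simp add: divide_le_eq mult.commute)
  next
    fix k :: nat assume k: "1 \<le> k" "real k \<le> min 1 ((sqrt 6 / (2 * pi)) ^ d * V) * real ?n"
    let ?S = "\<Sum>m=0..l. real (l choose m) * (- 1 / 12) ^ m * (2 * pi) ^ (2 * (l + m))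
                * (real d / real (d + 2 * (l + m)))
                * (real k / (V * real ?n)) powr (real (2 * (l + m)) / real d)"
    have kn: "k \<le> ?n" and n0: "real ?n > 0" and kV: "real k \<le> (sqrt 6 / (2 * pi)) ^ d * V * real ?n"
      using min_le[OF k(2)] k(1) by auto
    obtain r where r: "r > 0" "real ?n * (V * r ^ d) = (2 * pi) ^ d * real k"
      "\<And>j. r ^ (2 * j) = (2 * pi) ^ (2 * j) * (real k / (V * real ?n)) powr (real (2 * j) / real d)"
      "\<And>s. 0 \<le> s \<Longrightarrow> real k \<le> (s / (2 * pi)) ^ d * V * real ?n \<Longrightarrow> r \<le> s"
      using fermi_radius_exists[OF d0 n0 V0, of "real k"] k(1) by auto
    have r6: "r \<le> sqrt 6" using r(4)[OF _ kV] by simp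
    have S: "?S = (\<Sum>m\<le>l. real (l choose m) * (- 1 / 12) ^ m * (real CARD('d) / real (CARD('d) + 2 * (l + m))) * r ^ (2 * (l + m)))"
      unfolding r(3) assms(2) atMost_atLeast0 by (intro sum.cong refl) (simp only: mult_ac)
    show "?S \<le> 1 / real k * (\<Sum>j=1..k. dirichlet_eigenvalue l \<Omega> j)"
      unfolding S sum_eq using r(1) r6 k(1) kn by (intro eigenvalue_sum_ge vol[OF r(2)]) auto
    have "0 < unit_ball_vol (real CARD('d)) * r ^ CARD('d)"
      using r(1) by simp
    then show "0 < ?S"
      using minorant_ball_integral_pos[OF r(1) r6]
      unfolding S minorant_ball_integral[OF less_imp_le[OF r(1)] r6]
      by (rule zero_less_mult_pos[rotated])
  qed
qed

end
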